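(* Let $(X,\mathcal{R})$ be an imprimitive symmetric association scheme with $d=6$ classes which is cometric with respect to the ordering $E_0,E_1,\dots,E_6$ of its primitive idempotents, with first multiplicity $m=m_1>2$. Then it is impossible that its Krein array is $$\{b_0^*,\dots,b_5^*;c_1^*,\dots,c_6^*\}=\{m,m-1,1,b_3^*,b_4^*,1;\ 1,c_2^*,m-b_3^*,1,c_5^*,m\}$$ with $a_2^*=a_4^*+a_5^*$. In particular, every imprimitive cometric symmetric association scheme (with $d$ classes and $Q$-polynomial ordering $E_0,\dots,E_d$) with first multiplicity $m>2$ is $Q$-bipartite or $Q$-antipodal.
   Context: A symmetric association scheme with $d$ classes is a pair $(X,\mathcal{R})$, $X$ finite, $\mathcal{R}=\{R_0,\dots,R_d\}$ symmetric relations with adjacency matrices $A_i$ such that $A_0=I$, $\sum_i A_i=J$, and each $A_iA_j$ is a linear combination of the $A_h$. Its Bose–Mesner algebra has primitive idempotents $E_0=\frac{1}{|X|}J,E_1,\dots,E_d$; the Krein parameters $q_{ij}^h$ are defined by $E_i\circ E_j=\frac{1}{|X|}\sum_h q_{ij}^hE_h$ ($\circ$ = entrywise product), and $m_i=\mathrm{rank}(E_i)$. The scheme is imprimitive if some graph $(X,R_i)$, $1\le i\le d$, is disconnected. It is cometric ($Q$-polynomial) with respect to $E_0,\dots,E_d$ if $q_{ij}^h=0$ whenever $i+j<h$ and $q_{ij}^h\neq0$ whenever $i+j=h$. In that case set $m=m_1$, $a_i^*=q_{1i}^i$, $b_i^*=q_{1,i+1}^i$, $c_i^*=q_{1,i-1}^i$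 (so $a_i^*+b_i^*+c_i^*=m$); the Krein array is $\{b_0^*,\dots,b_{d-1}^*;c_1^*,\dots,c_d^*\}$. The scheme is $Q$-bipartite if $a_i^*=0$ for all $0\le i\le d$, and $Q$-antipodal if $b_i^*=c_{d-i}^*$ for all $0\le i\le d$ except possibly $i=\lfloor d/2\rfloor$. *)

theory Defs
  imports "HOL-Analysis.Analysis"
begin

definition adj :: "('x::finite \<Rightarrow> 'x \<Rightarrow> bool) \<Rightarrow> real^'x^'x" where
  "adj R = (\<chi> x y. if R x y then 1 else 0)"

definition allones :: "real^'x::finite^'x" where
  "allones = (\<chi> x y. 1)"

definition hadamard :: "real^'x::finite^'x \<Rightarrow> real^'x^'x \<Rightarrow> real^'x^'x" where
  "hadamard A B = (\<chi> x y. A $ x $ y * B $ x $ y)"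

definition sym_assoc_scheme :: "nat \<Rightarrow> (nat \<Rightarrow> 'x::finite \<Rightarrow> 'x \<Rightarrow> bool) \<Rightarrow> bool" where
  "sym_assoc_scheme d R \<longleftrightarrow>
     (\<forall>x y. R 0 x y \<longleftrightarrow> x = y) \<and>
     (\<forall>x y. \<exists>!i. i \<le> d \<and> R i x y) \<and>
     (\<forall>i\<le>d. \<exists>x y. R i x y) \<and>
     (\<forall>i\<le>d. \<forall>x y. R i x y \<longrightarrow> R i y x) \<and>
     (\<forall>i\<le>d. \<forall>j\<le>d. adj (R i) ** adj (R j) \<in> span (adj ` R ` {..d}))"

definition bose_mesner :: "nat \<Rightarrow> (nat \<Rightarrow> 'x::finite \<Rightarrow> 'x \<Rightarrow> bool) \<Rightarrow> (real^'x^'x) set" where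
  "bose_mesner d R = span ((\<lambda>i. adj (R i)) ` {..d})"

text \<open>E 0, ..., E d are the primitive idempotents of the Bose--Mesner algebra, with
  E 0 = J / |X|: nonzero pairwise orthogonal idempotents of the algebra summing to I
  (d+1 of them in the (d+1)-dimensional algebra, hence exactly the primitive idempotents).\<close>
definition primitive_idempotents ::
  "nat \<Rightarrow> (nat \<Rightarrow> 'x::finite \<Rightarrow> 'x \<Rightarrow> bool) \<Rightarrow> (nat \<Rightarrow> real^'x^'x) \<Rightarrow> bool" where
  "primitive_idempotents d R E \<longleftrightarrow>
     E 0 = (1 / real CARD('x)) *\<^sub>R allones \<and>
     (\<forall>i\<le>d. E i \<in> bose_mesner d R \<and> E i \<noteq> 0) \<and>
     (\<forall>i\<le>d. \<forall>j\<le>d. E i ** E j = (if i = j then E i else 0)) \<and>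
     (\<Sum>i\<le>d. E i) = mat 1"

text \<open>q are the Krein parameters: E_i \<circ> E_j = 1/|X| \<Sum>_h q_ij^h E_h (unique since the E_h
  are linearly independent).\<close>
definition krein_params ::
  "nat \<Rightarrow> (nat \<Rightarrow> real^'x::finite^'x) \<Rightarrow> (nat \<Rightarrow> nat \<Rightarrow> nat \<Rightarrow> real) \<Rightarrow> bool" where
  "krein_params d E q \<longleftrightarrow>
     (\<forall>i\<le>d. \<forall>j\<le>d. hadamard (E i) (E j) =
        (1 / real CARD('x)) *\<^sub>R (\<Sum>h\<le>d. q i j h *\<^sub>R E h))"

definition imprimitive :: "nat \<Rightarrow> (nat \<Rightarrow> 'x \<Rightarrow> 'x \<Rightarrow> bool) \<Rightarrow> bool" where
  "imprimitive d R \<longleftrightarrow> (\<exists>i. 1 \<le> i \<and> i \<le> d \<and> \<not> (\<forall>x y. (R i)\<^sup>*\<^sup>* x y))"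

definition cometric :: "nat \<Rightarrow> (nat \<Rightarrow> nat \<Rightarrow> nat \<Rightarrow> real) \<Rightarrow> bool" where
  "cometric d q \<longleftrightarrow>
     (\<forall>i\<le>d. \<forall>j\<le>d. \<forall>h\<le>d. (i + j < h \<longrightarrow> q i j h = 0) \<and> (i + j = h \<longrightarrow> q i j h \<noteq> 0))"

definition a_star :: "(nat \<Rightarrow> nat \<Rightarrow> nat \<Rightarrow> real) \<Rightarrow> nat \<Rightarrow> real" where
  "a_star q i = q 1 i i"

definition b_star :: "nat \<Rightarrow> (nat \<Rightarrow> nat \<Rightarrow> nat \<Rightarrow> real) \<Rightarrow> nat \<Rightarrow> real" where
  "b_star d q i = (if i < d then q 1 (i + 1) i else 0)"

definition c_star :: "(nat \<Rightarrow> nat \<Rightarrow> nat \<Rightarrow> real) \<Rightarrow> nat \<Rightarrow> real" where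
  "c_star q i = (if 0 < i then q 1 (i - 1) i else 0)"

definition Q_bipartite :: "nat \<Rightarrow> (nat \<Rightarrow> nat \<Rightarrow> nat \<Rightarrow> real) \<Rightarrow> bool" where
  "Q_bipartite d q \<longleftrightarrow> (\<forall>i\<le>d. a_star q i = 0)"

definition Q_antipodal :: "nat \<Rightarrow> (nat \<Rightarrow> nat \<Rightarrow> nat \<Rightarrow> real) \<Rightarrow> bool" where
  "Q_antipodal d q \<longleftrightarrow> (\<forall>i\<le>d. i \<noteq> d div 2 \<longrightarrow> b_star d q i = c_star q (d - i))"

definition excluded_krein_array :: "real \<Rightarrow> (nat \<Rightarrow> nat \<Rightarrow> nat \<Rightarrow> real) \<Rightarrow> bool" where
  "excluded_krein_array m q \<longleftrightarrow>
     b_star 6 q 0 = m \<and> b_star 6 q 1 = m - 1 \<and> b_star 6 q 2 = 1 \<and> b_star 6 q 5 = 1 \<and>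
     c_star q 1 = 1 \<and> c_star q 3 = m - b_star 6 q 3 \<and> c_star q 4 = 1 \<and> c_star q 6 = m \<and>
     a_star q 2 = a_star q 4 + a_star q 5"

end

theory Submission
  imports Defs
begin

text \<open>Write \<open>V\<^sub>i\<close> for the image of \<open>E\<^sub>i\<close>, a space of functions on \<open>X\<close>, and \<open>P\<^sub>i\<close> for the projection onto
  it. A Krein parameter \<open>q\<^sub>i\<^sub>j\<^sup>h\<close> vanishes exactly when the pointwise product of \<open>V\<^sub>i\<close> and \<open>V\<^sub>j\<close> is
  orthogonal to \<open>V\<^sub>h\<close>, so the proof works in the algebra of functions on \<open>X\<close>.

  Imprimitivity provides an index set \<open>J\<close>, neither trivial nor everything, closed under the Krein
  parameters. Let \<open>t\<close> be its least nonzero element. If \<open>t = d\<close>, the sums of \<open>q\<^sub>1\<^sub>k\<^sup>h\<close> over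
  \<open>k \<in> {i, d - i}\<close> are constant on the classes \<open>{h, d - h}\<close>, which gives the antipodal symmetry. If
  \<open>t = 2 < d\<close>, then \<open>a\<^sub>2 = 0\<close> forces \<open>a\<^sub>1 = 0\<close>, and every \<open>a\<^sub>i\<close> vanishes. If \<open>2 < t < d\<close>, then
  \<open>q\<^sub>1\<^sub>t\<^sup>t = q\<^sub>2\<^sub>t\<^sup>t = 0\<close> and \<open>b\<^sub>t\<^sub>-\<^sub>1 = 1\<close>. In that case, for \<open>f, g \<in> V\<^sub>1\<close> and \<open>\<tau> \<in> V\<^sub>t\<close>, the function
  \<open>g P\<^sub>t\<^sub>-\<^sub>1(f\<tau>)\<close> is symmetric in \<open>f\<close> and \<open>g\<close> up to its component in \<open>V\<^sub>t\<close>. Contracting over \<open>V\<^sub>1\<close> yields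
  \<open>m P\<^sub>t\<^sub>-\<^sub>1(f\<tau>) = c\<^sub>t f\<tau>\<close> when \<open>m > 2\<close>, contradicting \<open>P\<^sub>t\<^sub>+\<^sub>1(f\<tau>) \<noteq> 0\<close>. The same argument with \<open>t = 3\<close>
  excludes the exceptional Krein array directly.\<close>

declare One_nat_def [simp del]

lemma sum_rotate3:
  fixes h :: "'a \<Rightarrow> 'b \<Rightarrow> 'c \<Rightarrow> 'e \<Rightarrow> 'f::comm_monoid_add"
  shows "(\<Sum>x\<in>A. \<Sum>u\<in>B. \<Sum>v\<in>C. \<Sum>w\<in>D. h x u v w) = (\<Sum>u\<in>B. \<Sum>v\<in>C. \<Sum>w\<in>D. \<Sum>x\<in>A. h x u v w)"
proof -
  have "(\<Sum>x\<in>A. \<Sum>u\<in>B. \<Sum>v\<in>C. \<Sum>w\<in>D. h x u v w) = (\<Sum>u\<in>B. \<Sum>x\<in>A. \<Sum>v\<in>C. \<Sum>w\<in>D. h x u v w)"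
    by (rule sum.swap)
  also have "\<dots> = (\<Sum>u\<in>B. \<Sum>v\<in>C. \<Sum>x\<in>A. \<Sum>w\<in>D. h x u v w)"
    by (rule sum.cong[OF refl], rule sum.swap)
  also have "\<dots> = (\<Sum>u\<in>B. \<Sum>v\<in>C. \<Sum>w\<in>D. \<Sum>x\<in>A. h x u v w)"
    by (rule sum.cong[OF refl], rule sum.cong[OF refl], rule sum.swap)
  finally show ?thesis .
qed

section \<open>Projections onto the eigenspaces and the rows of the idempotents\<close>

text \<open>Of membership in the Bose--Mesner algebra the locale keeps symmetry and the constant
  diagonal, so that the arguments run in the algebra of functions on the points.\<close>

locale krein_algebra =
  fixes d :: nat
    and E :: "nat \<Rightarrow> real^'x::finite^'x"
    and q :: "nat \<Rightarrow> nat \<Rightarrow> nat \<Rightarrow> real"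
    and N :: real
  assumes N_eq: "N = real CARD('x)"
    and E_0: "E 0 = (1 / real CARD('x)) *\<^sub>R allones"
    and E_sym: "i \<le> d \<Longrightarrow> E i $ x $ y = E i $ y $ x"
    and E_diag: "i \<le> d \<Longrightarrow> E i $ x $ x = E i $ y $ y"
    and E_nonzero: "i \<le> d \<Longrightarrow> E i \<noteq> 0"
    and E_orth: "i \<le> d \<Longrightarrow> j \<le> d \<Longrightarrow> E i ** E j = (if i = j then E i else 0)"
    and E_sum: "(\<Sum>i\<le>d. E i) = mat 1"
    and krein: "krein_params d E q"
begin

definition P :: "nat \<Rightarrow> real^'x \<Rightarrow> real^'x" where "P i f = E i *v f"

lemma N_pos: "N > 0"
  by (simp add: N_eq)

lemma P_diff: "P i (f - g) = P i f - P i g"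
  by (simp add: P_def matrix_vector_mult_diff_distrib)

lemma P_scaleR: "P i (c *\<^sub>R f) = c *\<^sub>R P i f"
  by (simp add: P_def matrix_vector_mult_scaleR)

lemma P_zero [simp]: "P i 0 = 0"
  by (simp add: P_def)

lemma P_sum: "P i (\<Sum>y\<in>A. f y) = (\<Sum>y\<in>A. P i (f y))"
  by (simp add: P_def linear_sum[OF matrix_vector_mul_linear] o_def)

lemma P_nth: "P i f $ x = (\<Sum>y\<in>UNIV. E i $ x $ y * f $ y)"
  by (simp add: P_def matrix_vector_mult_def)

lemma P_P: "i \<le> d \<Longrightarrow> j \<le> d \<Longrightarrow> P i (P j f) = (if i = j then P i f else 0)"
  by (simp add: P_def matrix_vector_mul_assoc E_orth)

lemma sum_P: "(\<Sum>i\<le>d. P i f) = f"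
proof -
  have "(\<Sum>i\<le>d. P i f) = (\<Sum>i\<le>d. E i) *v f"
    by (simp add: P_def vec_eq_iff matrix_vector_mult_def sum_distrib_right sum.swap[of _ UNIV])
  then show ?thesis by (simp add: E_sum)
qed

lemma E_E: "i \<le> d \<Longrightarrow> j \<le> d \<Longrightarrow>
    (\<Sum>y\<in>UNIV. E i $ x $ y * E j $ y $ z) = (if i = j then E i $ x $ z else 0)"
  using arg_cong[OF E_orth, of i j "\<lambda>M. M $ x $ z"] by (simp add: matrix_matrix_mult_def)

lemma E_row_E_row: "i \<le> d \<Longrightarrow> (\<Sum>y\<in>UNIV. E i $ x $ y * E i $ z $ y) = E i $ x $ z"
proof -
  assume i: "i \<le> d"
  have "(\<Sum>y\<in>UNIV. E i $ x $ y * E i $ z $ y) = (\<Sum>y\<in>UNIV. E i $ x $ y * E i $ y $ z)"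
    by (intro sum.cong refl) (simp only: E_sym[OF i, of z])
  then show ?thesis by (simp add: E_E i)
qed

lemma P_inner: "i \<le> d \<Longrightarrow> inner (P i f) g = inner f (P i g)"
proof -
  assume i: "i \<le> d"
  have "inner (P i f) g = (\<Sum>x\<in>UNIV. \<Sum>y\<in>UNIV. E i $ x $ y * f $ y * g $ x)"
    by (simp add: inner_vec_def P_nth sum_distrib_right)
  also have "\<dots> = (\<Sum>y\<in>UNIV. \<Sum>x\<in>UNIV. E i $ x $ y * f $ y * g $ x)"
    by (rule sum.swap)
  also have "\<dots> = inner f (P i g)"
    by (simp add: inner_vec_def P_nth sum_distrib_left E_sym[OF i] mult_ac)
  finally show ?thesis .
qed

lemma P_0: "P 0 f = (inner f 1 / N) *\<^sub>R 1"
  by (simp add: vec_eq_iff P_nth E_0 N_eq allones_def inner_vec_def sum_divide_distrib)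

lemma krein_nth:
  assumes "i \<le> d" "j \<le> d"
  shows "E i $ x $ y * E j $ x $ y = (1 / N) * (\<Sum>h\<le>d. q i j h * E h $ x $ y)"
proof -
  have "hadamard (E i) (E j) = (1 / N) *\<^sub>R (\<Sum>h\<le>d. q i j h *\<^sub>R E h)"
    using krein assms unfolding krein_params_def N_eq by blast
  from arg_cong[OF this, of "\<lambda>M. M $ x $ y"] show ?thesis
    by (simp add: hadamard_def)
qed

text \<open>By symmetry a row of \<open>E i\<close> is also a column, the image of a point mass. The
  rows span \<open>V\<^sub>i\<close> and serve as its explicit test vectors.\<close>

lemma P_row:
  assumes "h \<le> d" "i \<le> d"
  shows "P h (E i $ y) = (if h = i then E i $ y else 0)"
proof (rule vec_eq_iff[THEN iffD2], rule allI)
  fix x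
  have "P h (E i $ y) $ x = (\<Sum>z\<in>UNIV. E h $ x $ z * E i $ z $ y)"
    by (simp add: P_nth E_sym[OF assms(2), of y])
  also have "\<dots> = (if h = i then E i $ y else 0) $ x"
    by (simp add: E_E assms E_sym[OF assms(2), of y])
  finally show "P h (E i $ y) $ x = (if h = i then E i $ y else 0) $ x" .
qed

lemma row_mult:
  assumes "i \<le> d" "j \<le> d"
  shows "E i $ y * E j $ y = (1 / N) *\<^sub>R (\<Sum>h\<le>d. q i j h *\<^sub>R E h $ y)"
  by (simp add: vec_eq_iff krein_nth[OF assms])

lemma P_row_mult:
  assumes "i \<le> d" "j \<le> d" "h \<le> d"
  shows "P h (E i $ y * E j $ y) = (q i j h / N) *\<^sub>R E h $ y"
proof -
  have "(\<Sum>k\<le>d. q i j k *\<^sub>R (if h = k then E k $ y else 0)) = q i j h *\<^sub>R E h $ y"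
    using assms by (simp add: if_distrib[of "\<lambda>v. _ *\<^sub>R v"] cong: if_cong)
  then show ?thesis
    using assms by (simp add: row_mult P_scaleR P_sum P_row)
qed

text \<open>Since \<open>E i\<close> is idempotent, contracting over its rows turns the left side
  into the operator with kernel \<open>hadamard (E i) (E j)\<close>, which the Krein expansion
  diagonalises.\<close>

lemma frame_mult:
  assumes "i \<le> d" "j \<le> d"
  shows "(\<Sum>y\<in>UNIV. E i $ y * P j (E i $ y * s)) = (1 / N) *\<^sub>R (\<Sum>h\<le>d. q i j h *\<^sub>R P h s)"
proof (rule vec_eq_iff[THEN iffD2], rule allI)
  fix x
  have "(\<Sum>y\<in>UNIV. E i $ y * P j (E i $ y * s)) $ x
      = (\<Sum>y\<in>UNIV. \<Sum>z\<in>UNIV. E i $ x $ y * E i $ y $ z * (E j $ x $ z * s $ z))"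
    by (simp add: P_nth sum_distrib_left mult_ac E_sym[OF assms(1), of x])
  also have "\<dots> = (\<Sum>z\<in>UNIV. (\<Sum>y\<in>UNIV. E i $ x $ y * E i $ y $ z) * (E j $ x $ z * s $ z))"
    by (subst sum.swap) (simp add: sum_distrib_right)
  also have "\<dots> = (\<Sum>z\<in>UNIV. (E i $ x $ z * E j $ x $ z) * s $ z)"
    by (intro sum.cong refl) (simp add: E_E assms(1) mult.assoc)
  also have "\<dots> = (\<Sum>z\<in>UNIV. \<Sum>h\<le>d. (1 / N) * (q i j h * (E h $ x $ z * s $ z)))"
    by (simp only: krein_nth[OF assms] sum_distrib_left sum_distrib_right mult.assoc)
  also have "\<dots> = ((1 / N) *\<^sub>R (\<Sum>h\<le>d. q i j h *\<^sub>R P h s)) $ x"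
    by (subst sum.swap) (simp add: P_nth sum_distrib_left)
  finally show "(\<Sum>y\<in>UNIV. E i $ y * P j (E i $ y * s)) $ x
      = ((1 / N) *\<^sub>R (\<Sum>h\<le>d. q i j h *\<^sub>R P h s)) $ x" .
qed

lemma frame_mult_eigen:
  assumes "i \<le> d" "j \<le> d" "k \<le> d" "P k s = s"
  shows "(\<Sum>y\<in>UNIV. E i $ y * P j (E i $ y * s)) = (q i j k / N) *\<^sub>R s"
proof -
  have "P h s = (if h = k then s else 0)" if "h \<le> d" for h
    using P_P[OF that assms(3), of s] assms(4) by auto
  then have "(\<Sum>h\<le>d. q i j h *\<^sub>R P h s) = (\<Sum>h\<le>d. if h = k then q i j k *\<^sub>R s else 0)"
    by (intro sum.cong) auto
  also have "\<dots> = q i j k *\<^sub>R s" using assms(3) by simp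
  finally show ?thesis using assms by (simp add: frame_mult)
qed

text \<open>A symmetric idempotent is its own Gram matrix, so its rows form a Parseval frame of the
  eigenspace.\<close>

lemma frame_expand:
  assumes "i \<le> d"
  shows "(\<Sum>y\<in>UNIV. inner g (E i $ y) *\<^sub>R E i $ y) = P i g"
proof (rule vec_eq_iff[THEN iffD2], rule allI)
  fix x
  have "(\<Sum>y\<in>UNIV. inner g (E i $ y) *\<^sub>R E i $ y) $ x
      = (\<Sum>y\<in>UNIV. \<Sum>z\<in>UNIV. E i $ x $ y * E i $ y $ z * g $ z)"
    by (simp add: inner_vec_def sum_distrib_left sum_distrib_right mult_ac E_sym[OF assms, of x])
  also have "\<dots> = (\<Sum>z\<in>UNIV. (\<Sum>y\<in>UNIV. E i $ x $ y * E i $ y $ z) * g $ z)"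
    by (subst sum.swap) (simp add: sum_distrib_right)
  also have "\<dots> = P i g $ x" using assms by (simp add: E_E P_nth)
  finally show "(\<Sum>y\<in>UNIV. inner g (E i $ y) *\<^sub>R E i $ y) $ x = P i g $ x" .
qed

lemma trace_E: "i \<le> d \<Longrightarrow> trace (E i) = (\<Sum>x\<in>UNIV. \<Sum>y\<in>UNIV. (E i $ x $ y)\<^sup>2)"
proof -
  assume i: "i \<le> d"
  have "E i $ x $ x = (\<Sum>y\<in>UNIV. (E i $ x $ y)\<^sup>2)" for x
    by (simp only: E_row_E_row[OF i] power2_eq_square)
  then show ?thesis by (simp add: trace_def)
qed

lemma trace_pos: "i \<le> d \<Longrightarrow> trace (E i) > 0"
proof -
  assume i: "i \<le> d"
  then obtain x y where xy: "E i $ x $ y \<noteq> 0"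
    using E_nonzero[OF i] by (auto simp: vec_eq_iff)
  have "(\<Sum>y\<in>UNIV. (E i $ x $ y)\<^sup>2) > 0"
    by (rule sum_pos2[of _ y]) (use xy in auto)
  then have "(\<Sum>x\<in>UNIV. \<Sum>y\<in>UNIV. (E i $ x $ y)\<^sup>2) > 0"
    by (rule sum_pos2[of _ x, rotated 2]) (auto intro: sum_nonneg)
  then show ?thesis by (simp only: trace_E[OF i])
qed

lemma E_diag_trace: "i \<le> d \<Longrightarrow> E i $ x $ x = trace (E i) / N"
proof -
  assume i: "i \<le> d"
  have "trace (E i) = (\<Sum>y\<in>(UNIV::'x set). E i $ x $ x)"
    unfolding trace_def by (rule sum.cong) (auto intro: E_diag[OF i])
  then show ?thesis by (simp add: N_eq)
qed

section \<open>Krein parameters as sums of squares\<close>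

text \<open>The entry sum of a triple Hadamard product. It is symmetric in all three indices and
  shows the symmetry that the Krein parameters have only up to multiplicities.\<close>

definition triple :: "nat \<Rightarrow> nat \<Rightarrow> nat \<Rightarrow> real" where
  "triple i j h = (\<Sum>x\<in>UNIV. \<Sum>y\<in>UNIV. E i $ x $ y * E j $ x $ y * E h $ x $ y)"

lemma triple_krein:
  assumes "i \<le> d" "j \<le> d" "h \<le> d"
  shows "N * triple i j h = q i j h * trace (E h)"
proof -
  have "N * triple i j h = (\<Sum>x\<in>UNIV. \<Sum>y\<in>UNIV. \<Sum>k\<le>d. q i j k * (E k $ x $ y * E h $ x $ y))"
    unfolding triple_def
    by (simp add: krein_nth[OF assms(1,2)] sum_distrib_left sum_distrib_right mult_ac N_eq)
  also have "\<dots> = (\<Sum>x\<in>UNIV. \<Sum>k\<le>d. q i j k * (\<Sum>y\<in>UNIV. E k $ x $ y * E h $ y $ x))"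
    by (subst sum.swap) (simp add: sum_distrib_left E_sym[OF assms(3), symmetric])
  also have "\<dots> = (\<Sum>x\<in>UNIV. \<Sum>k\<le>d. if k = h then q i j h * E h $ x $ x else 0)"
    by (intro sum.cong) (auto simp: E_E assms(3))
  also have "\<dots> = q i j h * trace (E h)"
    using assms(3) by (simp add: trace_def sum_distrib_left)
  finally show ?thesis .
qed

text \<open>Each entry \<open>E i $ x $ y\<close> is an inner product of rows \<open>x\<close> and
  \<open>y\<close>. Inserting this three times makes the sum over \<open>x\<close> and
  \<open>y\<close> a product of two equal factors: the squared norm of the trilinear form on the
  eigenspaces. Hence Krein parameters are nonnegative, and a zero one kills every coefficient of the
  form.\<close>

lemma triple_norm:
  assumes "i \<le> d" "j \<le> d" "h \<le> d"
  shows "triple i j h = (\<Sum>u\<in>UNIV. \<Sum>v\<in>UNIV. \<Sum>w\<in>UNIV.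
    (\<Sum>x\<in>UNIV. E i $ x $ u * E j $ x $ v * E h $ x $ w)\<^sup>2)" (is "_ = ?rhs")
proof -
  define g where "g x y u v w = (E i $ x $ u * E i $ y $ u) * (E j $ x $ v * E j $ y $ v) *
      (E h $ x $ w * E h $ y $ w)" for x y u v w
  have sq: "(\<Sum>x\<in>UNIV. E i $ x $ u * E j $ x $ v * E h $ x $ w)\<^sup>2 = (\<Sum>x\<in>UNIV. \<Sum>y\<in>UNIV. g x y u v w)"
    for u v w
    unfolding power2_eq_square sum_product g_def
    by (intro sum.cong refl) (simp only: mult_ac)
  have "triple i j h = (\<Sum>x\<in>UNIV. \<Sum>y\<in>UNIV. \<Sum>u\<in>UNIV. \<Sum>v\<in>UNIV. \<Sum>w\<in>UNIV. g x y u v w)"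
    unfolding triple_def g_def
    by (simp only: E_row_E_row assms flip: sum_distrib_left sum_distrib_right)
  also have "\<dots> = (\<Sum>x\<in>UNIV. \<Sum>u\<in>UNIV. \<Sum>v\<in>UNIV. \<Sum>w\<in>UNIV. \<Sum>y\<in>UNIV. g x y u v w)"
    by (rule sum.cong[OF refl], rule sum_rotate3)
  also have "\<dots> = (\<Sum>u\<in>UNIV. \<Sum>v\<in>UNIV. \<Sum>w\<in>UNIV. \<Sum>x\<in>UNIV. \<Sum>y\<in>UNIV. g x y u v w)"
    by (rule sum_rotate3)
  also have "\<dots> = ?rhs"
    by (simp only: sq)
  finally show ?thesis .
qed

lemma triple_commute: "triple i j h = triple j i h" "triple i j h = triple i h j"
  by (simp_all add: triple_def mult_ac)

lemma krein_eq_0_iff: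
  assumes "i \<le> d" "j \<le> d" "h \<le> d"
  shows "q i j h = 0 \<longleftrightarrow> triple i j h = 0"
  using triple_krein[OF assms] trace_pos[OF assms(3)] N_pos by auto

lemma krein_zero_commute:
  assumes "i \<le> d" "j \<le> d" "h \<le> d"
  shows "q i j h = 0 \<longleftrightarrow> q j i h = 0" "q i j h = 0 \<longleftrightarrow> q i h j = 0" "q i j h = 0 \<longleftrightarrow> q h j i = 0"
  using assms by (metis krein_eq_0_iff triple_commute)+

lemma krein_commute:
  assumes "i \<le> d" "j \<le> d" "h \<le> d"
  shows "q i j h = q j i h"
  using triple_krein[of i j h] triple_krein[of j i h] trace_pos[of h] assms
  by (simp add: triple_commute(1)[of i j])

lemma krein_nonneg:
  assumes "i \<le> d" "j \<le> d" "h \<le> d"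
  shows "q i j h \<ge> 0"
proof -
  have "N * triple i j h \<ge> 0"
    using N_pos unfolding triple_norm[OF assms] by (intro mult_nonneg_nonneg sum_nonneg) auto
  then show ?thesis
    using trace_pos[OF assms(3)] unfolding triple_krein[OF assms] by (simp add: zero_le_mult_iff)
qed

lemma krein_0:
  assumes "j \<le> d" "h \<le> d"
  shows "q 0 j h = (if j = h then 1 else 0)"
proof -
  have "N * triple 0 j h = (\<Sum>x\<in>UNIV. \<Sum>y\<in>UNIV. E j $ x $ y * E h $ y $ x)"
    using N_pos by (simp add: triple_def E_0 allones_def N_eq sum_distrib_left E_sym[OF assms(2), symmetric])
  also have "\<dots> = (if j = h then trace (E h) else 0)"
    using assms by (simp add: E_E trace_def)
  finally show ?thesis
    using triple_krein[of 0 j h] trace_pos[OF assms(2)] assms by (auto split: if_splits)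
qed

text \<open>Summing over \<open>l\<close> replaces \<open>E l\<close> by the identity, so only the
  diagonal entries survive, and these are constant.\<close>

lemma sum_krein:
  assumes "i \<le> d" "h \<le> d"
  shows "(\<Sum>l\<le>d. q i l h) = trace (E i)"
proof -
  have I: "(\<Sum>l\<le>d. E l $ x $ y) = (if x = y then 1 else 0)" for x y
    using arg_cong[OF E_sum, of "\<lambda>M. M $ x $ y"] by (simp add: mat_def)
  have "(\<Sum>l\<le>d. q i l h) * trace (E h) = (\<Sum>l\<le>d. N * triple i l h)"
    using assms by (simp add: triple_krein sum_distrib_right)
  also have "\<dots> = N * (\<Sum>x\<in>UNIV. \<Sum>y\<in>UNIV. (\<Sum>l\<le>d. E l $ x $ y) * (E i $ x $ y * E h $ x $ y))"
  proof -
    have "(\<Sum>l\<le>d. triple i l h) =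
        (\<Sum>x\<in>UNIV. \<Sum>l\<le>d. \<Sum>y\<in>UNIV. E l $ x $ y * (E i $ x $ y * E h $ x $ y))"
      unfolding triple_def by (subst sum.swap) (simp add: mult_ac)
    also have "\<dots> = (\<Sum>x\<in>UNIV. \<Sum>y\<in>UNIV. (\<Sum>l\<le>d. E l $ x $ y) * (E i $ x $ y * E h $ x $ y))"
      unfolding sum_distrib_right by (rule sum.cong[OF refl], rule sum.swap)
    finally show ?thesis by (simp add: sum_distrib_left[symmetric])
  qed
  also have "\<dots> = N * (\<Sum>x\<in>(UNIV::'x set). (trace (E i) / N) * (trace (E h) / N))"
    unfolding I by (simp add: E_diag_trace[OF assms(1)] E_diag_trace[OF assms(2)] if_distrib[of "\<lambda>c. c * _"] cong: if_cong)
  also have "\<dots> = trace (E i) * trace (E h)"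
    using N_pos by (simp add: N_eq)
  finally show ?thesis using trace_pos[OF assms(2)] by simp
qed

section \<open>Products of eigenspaces and closed index sets\<close>

text \<open>By \<open>triple_norm\<close> all coefficients \<open>K u v\<close> of the trilinear
  form vanish. Bilinear expansion of \<open>f\<close> and \<open>g\<close> extends this from rows to
  whole eigenspaces.\<close>

lemma P_mult_zero:
  assumes "i \<le> d" "j \<le> d" "h \<le> d" "q i j h = 0" "P i f = f" "P j g = g"
  shows "P h (f * g) = 0"
proof (rule vec_eq_iff[THEN iffD2], rule allI)
  fix w
  define K where "K u v = (\<Sum>x\<in>UNIV. E i $ x $ u * E j $ x $ v * E h $ x $ w)" for u v
  have "(\<Sum>u\<in>UNIV. \<Sum>v\<in>UNIV. \<Sum>w\<in>UNIV. (\<Sum>x\<in>UNIV. E i $ x $ u * E j $ x $ v * E h $ x $ w)\<^sup>2) = 0"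
    using triple_norm[OF assms(1-3)] krein_eq_0_iff[OF assms(1-3)] assms(4) by simp
  then have K: "K u v = 0" for u v
    unfolding K_def by (simp add: sum_nonneg_eq_0_iff sum_nonneg)
  have "P h (f * g) $ w = (\<Sum>x\<in>UNIV. E h $ w $ x * (P i f $ x * P j g $ x))"
    by (simp add: P_nth[of h] assms(5,6))
  also have "\<dots> = (\<Sum>x\<in>UNIV. \<Sum>u\<in>UNIV. \<Sum>v\<in>UNIV. f $ u * g $ v * (E i $ x $ u * E j $ x $ v * E h $ x $ w))"
    unfolding P_nth[of i] P_nth[of j] sum_product
    unfolding sum_distrib_left E_sym[OF assms(3), of w]
    by (intro sum.cong refl) (simp only: mult_ac)
  also have "\<dots> = (\<Sum>u\<in>UNIV. \<Sum>x\<in>UNIV. \<Sum>v\<in>UNIV. f $ u * g $ v * (E i $ x $ u * E j $ x $ v * E h $ x $ w))"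
    by (rule sum.swap)
  also have "\<dots> = (\<Sum>u\<in>UNIV. \<Sum>v\<in>UNIV. f $ u * g $ v * K u v)"
    unfolding K_def sum_distrib_left by (rule sum.cong[OF refl], rule sum.swap)
  finally show "P h (f * g) $ w = 0 $ w" by (simp add: K)
qed

text \<open>The projection onto the eigenspaces indexed by \<open>C\<close> commutes with multiplication by
  functions in the \<open>j\<close>-th eigenspace, and hence so does its entrywise product with \<open>E i\<close>, whose
  eigenvalues are the two sums, up to a factor.\<close>
lemma sum_krein_closed:
  assumes C: "C \<subseteq> {..d}" and j: "j \<le> d"
    and closed: "\<And>h l. h \<in> C \<Longrightarrow> l \<le> d \<Longrightarrow> q j h l \<noteq> 0 \<Longrightarrow> l \<in> C"
    and i: "i \<le> d" and hl: "h \<le> d" "l \<le> d" "q j h l \<noteq> 0"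
  shows "(\<Sum>k\<in>C. q i k h) = (\<Sum>k\<in>C. q i k l)"
proof -
  define Q where "Q f = (\<Sum>k\<in>C. P k f)" for f
  have Cd: "k \<le> d" if "k \<in> C" for k using C that by auto
  have fin: "finite C" using C finite_subset by blast
  have Q_mult: "Q (\<tau> * f) = \<tau> * Q f" if \<tau>: "P j \<tau> = \<tau>" for \<tau> f
  proof -
    \<comment> \<open>The cross terms vanish in both directions: \<open>q j b a\<close> and
      \<open>q j a b\<close> are zero together, so the complement of \<open>C\<close> is closed as
      well.\<close>
    have z: "P a (\<tau> * P b f) = 0" if "a \<le> d" "b \<le> d" "a \<in> C \<longleftrightarrow> b \<notin> C" for a b
    proof (rule P_mult_zero[of j b])
      show "q j b a = 0"
        using that closed[of b a] closed[of a b] krein_zero_commute(2)[of j b a] j by auto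
    qed (use that j \<tau> P_P[of b b f] in auto)
    have "Q (\<tau> * f) = (\<Sum>a\<in>C. \<Sum>b\<le>d. P a (\<tau> * P b f))"
      unfolding Q_def by (simp add: sum_P flip: P_sum sum_distrib_left)
    also have "\<dots> = (\<Sum>a\<in>C. \<Sum>b\<in>C. P a (\<tau> * P b f))"
      using C Cd z by (intro sum.cong refl sum.mono_neutral_right) auto
    also have "\<dots> = (\<Sum>b\<in>C. \<Sum>a\<in>C. P a (\<tau> * P b f))" by (rule sum.swap)
    also have "\<dots> = (\<Sum>b\<in>C. \<Sum>a\<le>d. P a (\<tau> * P b f))"
      using C Cd z by (intro sum.cong refl sum.mono_neutral_left) auto
    also have "\<dots> = \<tau> * Q f" by (simp add: sum_P Q_def sum_distrib_left)
    finally show ?thesis .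
  qed
  define K where "K x y = (\<Sum>k\<in>C. E k $ x $ y)" for x y
  \<comment> \<open>Testing on point masses turns commutation into a statement on the kernel:
    \<open>K x y\<close> is zero unless \<open>\<tau>\<close> agrees at \<open>x\<close> and
    \<open>y\<close>. This survives entrywise multiplication of \<open>K\<close> by any
    matrix.\<close>
  have K: "K x y * \<tau> $ y = \<tau> $ x * K x y" if \<tau>: "P j \<tau> = \<tau>" for \<tau> x y
  proof -
    have *: "Q (axis y 1) $ x = K x y" for x
      by (simp add: Q_def K_def P_def matrix_vector_mul_component inner_axis)
    have "\<tau> * axis y 1 = (\<tau> $ y) *\<^sub>R axis y 1"
      by (simp add: vec_eq_iff axis_def)
    then have "Q (\<tau> * axis y 1) = (\<tau> $ y) *\<^sub>R Q (axis y 1)"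
      by (simp add: Q_def P_scaleR scaleR_sum_right)
    with Q_mult[OF \<tau>, of "axis y 1"] have "(\<tau> * Q (axis y 1)) $ x = ((\<tau> $ y) *\<^sub>R Q (axis y 1)) $ x"
      by simp
    then show ?thesis by (auto simp: *)
  qed
  define w where "w h = (\<Sum>k\<in>C. q i k h)" for h
  define T where "T f = (\<chi> x. \<Sum>y\<in>UNIV. E i $ x $ y * (K x y * f $ y))" for f :: "real^'x"
  have T_mult: "T (\<tau> * f) = \<tau> * T f" if \<tau>: "P j \<tau> = \<tau>" for \<tau> f
  proof -
    have "E i $ x $ y * (K x y * (\<tau> * f) $ y) = \<tau> $ x * (E i $ x $ y * (K x y * f $ y))" for x y
    proof -
      have "E i $ x $ y * (K x y * (\<tau> * f) $ y) = E i $ x $ y * ((K x y * \<tau> $ y) * f $ y)"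
        by simp
      also have "\<dots> = \<tau> $ x * (E i $ x $ y * (K x y * f $ y))"
        unfolding K[OF \<tau>] by simp
      finally show ?thesis .
    qed
    then show ?thesis by (simp only: T_def vec_eq_iff vec_lambda_beta vector_mult_component sum_distrib_left) simp
  qed
  have T: "T f = (1 / N) *\<^sub>R (\<Sum>h\<le>d. w h *\<^sub>R P h f)" for f
  proof (rule vec_eq_iff[THEN iffD2], rule allI)
    fix x
    have "E i $ x $ y * K x y = (1 / N) * (\<Sum>h\<le>d. w h * E h $ x $ y)" for y
    proof -
      have "E i $ x $ y * K x y = (\<Sum>k\<in>C. (1 / N) * (\<Sum>h\<le>d. q i k h * E h $ x $ y))"
        unfolding K_def sum_distrib_left by (intro sum.cong refl) (simp add: krein_nth i Cd sum_distrib_left)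
      also have "\<dots> = (1 / N) * (\<Sum>h\<le>d. w h * E h $ x $ y)"
        unfolding w_def sum_distrib_right sum_distrib_left by (rule sum.swap)
      finally show ?thesis .
    qed
    then have "T f $ x = (\<Sum>y\<in>UNIV. \<Sum>h\<le>d. (1 / N) * (w h * (E h $ x $ y * f $ y)))"
      by (simp add: T_def sum_distrib_left sum_distrib_right flip: mult.assoc)
    also have "\<dots> = ((1 / N) *\<^sub>R (\<Sum>h\<le>d. w h *\<^sub>R P h f)) $ x"
      by (subst sum.swap) (simp add: P_nth sum_distrib_left)
    finally show "T f $ x = ((1 / N) *\<^sub>R (\<Sum>h\<le>d. w h *\<^sub>R P h f)) $ x" .
  qed
  have PT: "P k (T f) = (w k / N) *\<^sub>R P k f" if "k \<le> d" for k f
  proof -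
    have "(\<Sum>h\<le>d. w h *\<^sub>R P k (P h f)) = (\<Sum>h\<le>d. if h = k then w k *\<^sub>R P k f else 0)"
      using that by (intro sum.cong) (auto simp: P_P)
    then show ?thesis using that by (simp add: T P_scaleR P_sum)
  qed
  obtain y where y: "E l $ y \<noteq> 0" using E_nonzero[OF hl(2)] by (auto simp: vec_eq_iff)
  have Th: "T (E h $ y) = (w h / N) *\<^sub>R E h $ y"
  proof -
    have "T (E h $ y) = (\<Sum>k\<le>d. P k (T (E h $ y)))" by (simp add: sum_P)
    also have "\<dots> = (\<Sum>k\<le>d. if k = h then (w h / N) *\<^sub>R E h $ y else 0)"
      using hl by (intro sum.cong) (auto simp: PT P_row)
    finally show ?thesis using hl by simp
  qed
  \<comment> \<open>The row product has a nonzero component in \<open>V\<^sub>l\<close> because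
    \<open>q j h l\<close> is nonzero, so the eigenvalues of \<open>T\<close> at \<open>h\<close>
    and \<open>l\<close> can be compared on it.\<close>
  have "P l (T (E j $ y * E h $ y)) = P l (E j $ y * T (E h $ y))"
    using T_mult[of "E j $ y"] P_row[OF j j] by simp
  then have "(w l / N) *\<^sub>R P l (E j $ y * E h $ y) = (w h / N) *\<^sub>R P l (E j $ y * E h $ y)"
    by (simp add: PT[OF hl(2)] Th P_scaleR)
  then have "w l = w h"
    using y hl N_pos by (simp add: P_row_mult j)
  then show ?thesis by (simp add: w_def)
qed

text \<open>Associativity of the pointwise product of three rows at the same point, read off in the
  component \<open>V\<^sub>h\<close>.\<close>

lemma krein_assoc:
  assumes "i \<le> d" "j \<le> d" "l \<le> d" "h \<le> d"
  shows "(\<Sum>k\<le>d. q i j k * q k l h) = (\<Sum>k\<le>d. q j l k * q i k h)"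
proof -
  obtain y where y: "E h $ y \<noteq> 0" using E_nonzero[OF assms(4)] by (auto simp: vec_eq_iff)
  have "P h ((E i $ y * E j $ y) * E l $ y) = (1 / N) *\<^sub>R (1 / N) *\<^sub>R (\<Sum>k\<le>d. q i j k * q k l h) *\<^sub>R E h $ y"
    using assms by (simp add: row_mult[OF assms(1,2)] sum_distrib_right P_scaleR P_sum P_row_mult
        scaleR_sum_left scaleR_sum_right)
  moreover have "P h (E i $ y * (E j $ y * E l $ y)) = (1 / N) *\<^sub>R (1 / N) *\<^sub>R (\<Sum>k\<le>d. q j l k * q i k h) *\<^sub>R E h $ y"
    using assms by (simp add: row_mult[OF assms(2,3)] sum_distrib_left P_scaleR P_sum P_row_mult
        scaleR_sum_left scaleR_sum_right)
  ultimately show ?thesis using y N_pos by (simp add: mult.assoc)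
qed

section \<open>From imprimitivity to a closed index set\<close>

text \<open>The \<open>d + 1\<close> idempotents are nonzero and orthogonal for the entrywise inner
  product, hence independent. The algebra is spanned by \<open>d + 1\<close> matrices, so they form
  a basis.\<close>

lemma span_E:
  assumes "\<And>i. i \<le> d \<Longrightarrow> E i \<in> bose_mesner d R" and "A \<in> bose_mesner d R"
  obtains p where "A = (\<Sum>i\<le>d. p i *\<^sub>R E i)"
proof -
  have orth: "inner (E i) (E j) = 0" if "i \<le> d" "j \<le> d" "i \<noteq> j" for i j
  proof -
    have "inner (E i) (E j) = (\<Sum>x\<in>UNIV. \<Sum>y\<in>UNIV. E i $ x $ y * E j $ y $ x)"
      by (simp add: inner_vec_def E_sym[OF that(2), symmetric])
    then show ?thesis using that by (simp add: E_E)
  qed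
  have inj: "inj_on E {..d}"
    using orth E_nonzero by (intro inj_onI) (metis atMost_iff inner_eq_zero_iff)
  have ind: "independent (E ` {..d})"
    using orth E_nonzero by (intro pairwise_orthogonal_independent) (auto simp: pairwise_def orthogonal_def)
  have "dim (bose_mesner d R) \<le> card ((\<lambda>i. adj (R i)) ` {..d})"
    unfolding bose_mesner_def dim_span by (rule dim_le_card') simp
  also have "\<dots> \<le> card (E ` {..d})"
    using card_image_le[of "{..d}" "\<lambda>i. adj (R i)"] by (simp add: card_image inj)
  finally have "bose_mesner d R \<subseteq> span (E ` {..d})"
    using assms(1) ind by (intro card_ge_dim_independent) auto
  then obtain u where "A = (\<Sum>v\<in>E ` {..d}. u v *\<^sub>R v)"
    using assms(2) by (auto simp: span_finite)
  then have "A = (\<Sum>i\<le>d. u (E i) *\<^sub>R E i)" by (simp add: sum.reindex inj)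
  then show ?thesis by (rule that)
qed

text \<open>The eigenvectors of a relation for its valency are the functions that are constant on its
  connected components, and products of such functions are again of this kind.\<close>
lemma imprimitive_closed_set:
  assumes S: "\<And>x y. S x y \<longleftrightarrow> S y x" and A: "adj S = (\<Sum>i\<le>d. p i *\<^sub>R E i)"
    and edge: "\<exists>x y. S x y \<and> x \<noteq> y" and disc: "\<exists>x y. \<not> S\<^sup>*\<^sup>* x y"
  obtains J where "J \<subseteq> {..d}" "0 \<in> J" "J \<noteq> {0}" "J \<noteq> {..d}"
    "\<And>i j h. i \<in> J \<Longrightarrow> j \<in> J \<Longrightarrow> h \<le> d \<Longrightarrow> q i j h \<noteq> 0 \<Longrightarrow> h \<in> J"
proof
  \<comment> \<open>Here \<open>p 0\<close> is the valency: \<open>J\<close> collects the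
    eigenspaces belonging to it, and \<open>H\<close> describes the sum of these eigenspaces through
    the edges.\<close>
  define J where "J = {j. j \<le> d \<and> p j = p 0}"
  define H where "H = {f :: real^'x. \<forall>x y. S x y \<longrightarrow> f $ x = f $ y}"
  have PA: "P i (adj S *v f) = p i *\<^sub>R P i f" if i: "i \<le> d" for i f
  proof -
    have "adj S *v f = (\<Sum>j\<le>d. p j *\<^sub>R P j f)"
      unfolding A by (simp add: vec_eq_iff P_nth matrix_vector_mult_def sum_distrib_left sum_distrib_right
          mult.assoc sum.swap[of _ UNIV])
    moreover have "(\<Sum>j\<le>d. p j *\<^sub>R P i (P j f)) = (\<Sum>j\<le>d. if j = i then p i *\<^sub>R P i f else 0)"
      using i by (intro sum.cong) (auto simp: P_P)
    ultimately show ?thesis using i by (simp add: P_sum P_scaleR)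
  qed
  have eig: "adj S *v f = p 0 *\<^sub>R f \<longleftrightarrow> (\<forall>h\<le>d. h \<notin> J \<longrightarrow> P h f = 0)" for f
  proof -
    have "adj S *v f = p 0 *\<^sub>R f \<longleftrightarrow> (\<forall>h\<le>d. P h (adj S *v f) = P h (p 0 *\<^sub>R f))"
    proof
      assume *: "\<forall>h\<le>d. P h (adj S *v f) = P h (p 0 *\<^sub>R f)"
      have "(\<Sum>h\<le>d. P h (adj S *v f)) = (\<Sum>h\<le>d. P h (p 0 *\<^sub>R f))"
        using * by (intro sum.cong) auto
      then show "adj S *v f = p 0 *\<^sub>R f" by (simp only: sum_P)
    qed simp
    also have "\<dots> \<longleftrightarrow> (\<forall>h\<le>d. h \<notin> J \<longrightarrow> P h f = 0)"
      by (auto simp: PA P_scaleR J_def)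
    finally show ?thesis .
  qed
  have val: "(\<Sum>y\<in>UNIV. adj S $ x $ y) = p 0" for x
  proof -
    have P1: "P h 1 = 0" if "h \<le> d" "h \<noteq> 0" for h
      using P_P[of h 0 1] that N_pos by (simp add: P_0 P_scaleR inner_vec_def)
    have "adj S *v 1 = p 0 *\<^sub>R 1"
      unfolding eig using P1 by (auto simp: J_def)
    from arg_cong[OF this, of "\<lambda>f. f $ x"] show ?thesis by (simp add: matrix_vector_mult_def)
  qed
  have adjS: "adj S $ x $ y = (if S x y then 1 else 0)" for x y by (simp add: adj_def)
  have H: "f \<in> H \<longleftrightarrow> (\<forall>h\<le>d. h \<notin> J \<longrightarrow> P h f = 0)" for f
    unfolding eig[symmetric]
  proof
    assume f: "f \<in> H"
    have "(adj S *v f) $ x = (p 0 *\<^sub>R f) $ x" for x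
    proof -
      have "(adj S *v f) $ x = (\<Sum>y\<in>UNIV. adj S $ x $ y * f $ x)"
        unfolding matrix_vector_mult_def using f by (auto simp: H_def adjS intro: sum.cong)
      then show ?thesis by (simp add: val flip: sum_distrib_right)
    qed
    then show "adj S *v f = p 0 *\<^sub>R f" by (simp add: vec_eq_iff)
  next
    \<comment> \<open>The valency equation makes the Dirichlet form, the sum of
      \<open>(f $ x - f $ y)\<^sup>2\<close> over the edges, equal to zero.\<close>
    assume f: "adj S *v f = p 0 *\<^sub>R f"
    have fx: "(\<Sum>y\<in>UNIV. adj S $ x $ y * f $ y) = p 0 * f $ x" for x
      using arg_cong[OF f, of "\<lambda>f. f $ x"] by (simp add: matrix_vector_mult_def)
    have sq: "(\<Sum>x\<in>UNIV. \<Sum>y\<in>UNIV. adj S $ x $ y * (f $ x)\<^sup>2) = p 0 * (\<Sum>x\<in>UNIV. (f $ x)\<^sup>2)"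
      by (simp add: val sum_distrib_left flip: sum_distrib_right)
    have "(\<Sum>x\<in>UNIV. \<Sum>y\<in>UNIV. adj S $ x $ y * (f $ y)\<^sup>2) = (\<Sum>x\<in>UNIV. \<Sum>y\<in>UNIV. adj S $ x $ y * (f $ x)\<^sup>2)"
      by (subst sum.swap) (simp add: adjS S)
    moreover have "(\<Sum>x\<in>UNIV. \<Sum>y\<in>UNIV. adj S $ x $ y * (f $ x * f $ y)) = p 0 * (\<Sum>x\<in>UNIV. (f $ x)\<^sup>2)"
    proof -
      have "(\<Sum>y\<in>UNIV. adj S $ x $ y * (f $ x * f $ y)) = p 0 * (f $ x)\<^sup>2" for x
      proof -
        have "(\<Sum>y\<in>UNIV. adj S $ x $ y * (f $ x * f $ y)) = f $ x * (\<Sum>y\<in>UNIV. adj S $ x $ y * f $ y)"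
          by (simp add: sum_distrib_left mult_ac)
        then show ?thesis by (simp add: fx power2_eq_square)
      qed
      then show ?thesis by (simp only: sum_distrib_left)
    qed
    moreover have "(\<Sum>x\<in>UNIV. \<Sum>y\<in>UNIV. adj S $ x $ y * (f $ x - f $ y)\<^sup>2) =
        (\<Sum>x\<in>UNIV. \<Sum>y\<in>UNIV. adj S $ x $ y * (f $ x)\<^sup>2) + (\<Sum>x\<in>UNIV. \<Sum>y\<in>UNIV. adj S $ x $ y * (f $ y)\<^sup>2)
        - 2 * (\<Sum>x\<in>UNIV. \<Sum>y\<in>UNIV. adj S $ x $ y * (f $ x * f $ y))"
      by (simp add: power2_diff sum.distrib sum_subtractf sum_distrib_left algebra_simps)
    ultimately have "(\<Sum>x\<in>UNIV. \<Sum>y\<in>UNIV. adj S $ x $ y * (f $ x - f $ y)\<^sup>2) = 0"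
      using sq by simp
    then have "adj S $ x $ y * (f $ x - f $ y)\<^sup>2 = 0" for x y
      by (simp add: adjS sum_nonneg_eq_0_iff sum_nonneg)
    then have "f $ x = f $ y" if "S x y" for x y
      using that by (metis adjS mult_1 power_eq_0_iff right_minus_eq)
    then show "f \<in> H" by (simp add: H_def)
  qed
  show "J \<subseteq> {..d}" "0 \<in> J" by (auto simp: J_def)
  show "h \<in> J" if "i \<in> J" "j \<in> J" "h \<le> d" "q i j h \<noteq> 0" for i j h
  proof (rule ccontr)
    assume "h \<notin> J"
    have ij: "i \<le> d" "j \<le> d" using that by (auto simp: J_def)
    have "E k $ y \<in> H" if "k \<in> J" for k y
      unfolding H using that by (auto simp: P_row J_def)
    then have "E i $ y * E j $ y \<in> H" for y
      using that by (simp add: H_def)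
    then have "P h (E i $ y * E j $ y) = 0" for y
      using H \<open>h \<notin> J\<close> that by blast
    then have "E h $ y = 0" for y
      using that N_pos by (simp add: P_row_mult ij)
    then show False using E_nonzero[OF that(3)] by (simp add: vec_eq_iff)
  qed
  show "J \<noteq> {0}"
  proof
    assume J: "J = {0}"
    obtain x y where xy: "\<not> S\<^sup>*\<^sup>* x y" using disc by auto
    \<comment> \<open>The indicator of a component lies in \<open>H\<close> but is not constant,
      whereas \<open>J = {0}\<close> would leave only constants.\<close>
    define f :: "real^'x" where "f = (\<chi> z. if S\<^sup>*\<^sup>* x z then 1 else 0)"
    have "f \<in> H"
      using S by (auto simp: H_def f_def intro: rtranclp.rtrancl_into_rtrancl)
    then have "P h f = 0" if "h \<in> {..d} - {0}" for h using H J that by auto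
    then have "(\<Sum>h\<le>d. P h f) = (\<Sum>h\<in>{0}. P h f)"
      by (intro sum.mono_neutral_right) auto
    then have "f = (inner f 1 / N) *\<^sub>R 1" by (simp add: sum_P P_0)
    then have "f $ x = f $ y" by (metis one_index vector_scaleR_component)
    then show False using xy by (simp add: f_def)
  qed
  show "J \<noteq> {..d}"
  proof
    assume "J = {..d}"
    obtain x y where xy: "S x y" "x \<noteq> y" using edge by auto
    have "axis x 1 \<in> H" unfolding H using \<open>J = {..d}\<close> by auto
    then have "axis x (1::real) $ x = axis x 1 $ y" using xy unfolding H_def by blast
    then show False using xy by (simp add: axis_def)
  qed
qed

end

section \<open>Cometric orderings and the interior obstruction\<close>

locale cometric_algebra = krein_algebra d E q N
  for d and E :: "nat \<Rightarrow> real^'x::finite^'x" and q N +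
  assumes cometric: "cometric d q"
begin

text \<open>The cometric condition treats only a large upper index; vanishing is invariant under
  permuting the three indices, which gives the other two cases.\<close>

lemma krein_triangle:
  assumes "i \<le> d" "j \<le> d" "h \<le> d" "i + j < h \<or> i + h < j \<or> j + h < i"
  shows "q i j h = 0"
proof -
  have c: "q a b c = 0" if "a \<le> d" "b \<le> d" "c \<le> d" "a + b < c" for a b c
    using cometric that unfolding cometric_def by blast
  show ?thesis
    using assms c[of i j h] c[of i h j] c[of h j i] krein_zero_commute[of i j h]
    by (metis add.commute)
qed

lemma krein_add_neq_0:
  assumes "i + j \<le> d"
  shows "q i j (i + j) \<noteq> 0" "q i (i + j) j \<noteq> 0"
proof -
  show "q i j (i + j) \<noteq> 0"
    using cometric assms unfolding cometric_def by (metis add_leD1 add_leD2)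
  then show "q i (i + j) j \<noteq> 0"
    using krein_zero_commute(2)[of i j "i + j"] assms by auto
qed

lemma P_mult_nonadjacent:
  assumes "1 \<le> d" "j \<le> d" "h \<le> d" "j + 1 < h \<or> h + 1 < j" "P 1 f = f" "P j g = g"
  shows "P h (f * g) = 0"
  using assms by (intro P_mult_zero[of 1 j]) (auto intro: krein_triangle)

text \<open>The map \<open>L g f\<close> below satisfies a linear relation with its transpose \<open>L f g\<close>. For \<open>m > 2\<close> it is
  therefore symmetric and scalar, so that multiplication by the first eigenspace maps the \<open>t\<close>-th one
  into the \<open>(t - 1)\<close>-th one only.\<close>
lemma no_interior_unit_b_star:
  assumes t: "2 \<le> t" "t < d"
    and at: "q 1 t t = 0" and q2: "q 2 t t = 0" and bt: "q 1 t (t - 1) = 1"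
    and m: "trace (E 1) > 2"
  shows False
proof -
  define m where "m = trace (E 1)"
  define c where "c = q 1 (t - 1) t"
  have le: "0 \<le> d" "1 \<le> d" "2 \<le> d" "t \<le> d" "t - 1 \<le> d" using t by auto
  have PP: "P k (P k f) = P k f" if "k \<le> d" for k f
    using P_P[OF that that] by simp
  \<comment> \<open>The product \<open>f * g\<close> lives in \<open>V\<^sub>0\<close>,
    \<open>V\<^sub>1\<close> and \<open>V\<^sub>2\<close>. The hypotheses \<open>at\<close> and
    \<open>q2\<close> remove the last two, so only its mean value acts.\<close>
  have mult_t: "P t (f * g * \<tau>) = (inner f g / N) *\<^sub>R \<tau>"
    if f: "P 1 f = f" and g: "P 1 g = g" and \<tau>: "P t \<tau> = \<tau>" for f g \<tau>
  proof -
    have z: "P t (P k (f * g) * \<tau>) = (if k = 0 then (inner f g / N) *\<^sub>R \<tau> else 0)" if k: "k \<le> d" for k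
    proof -
      consider "k = 0" | "k = 1" | "k = 2" | "k > 2" by linarith
      then show ?thesis
      proof cases
        case 1
        have "inner (f * g) 1 = inner f g" by (simp add: inner_vec_def)
        then show ?thesis using 1 \<tau> by (simp add: P_0 P_scaleR)
      next
        case 2
        then show ?thesis using P_mult_zero[OF le(2) le(4) le(4) at PP[OF le(2)] \<tau>] by simp
      next
        case 3
        then show ?thesis using P_mult_zero[OF le(3) le(4) le(4) q2 PP[OF le(3)] \<tau>] by simp
      next
        case 4
        then have "q 1 1 k = 0" using k le by (intro krein_triangle) auto
        then show ?thesis using P_mult_zero[OF le(2) le(2) k _ f g] 4 by simp
      qed
    qed
    have "P t (f * g * \<tau>) = P t (\<Sum>k\<le>d. P k (f * g) * \<tau>)"
      by (simp add: sum_P flip: sum_distrib_right)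
    then show ?thesis by (simp add: P_sum z)
  qed
  have main: "m *\<^sub>R P (t - 1) (f * \<tau>) = c *\<^sub>R (f * \<tau>)"
    if f: "P 1 f = f" and \<tau>: "P t \<tau> = \<tau>" for f \<tau>
  proof -
    define F where "F f = P (t - 1) (f * \<tau>)" for f
    define L where "L g f = P t (g * F f)" for f g
    have PF: "P (t - 1) (F f) = F f" for f
      unfolding F_def by (rule PP[OF le(5)])
    have PL: "P t (L g f) = L g f" for f g
      unfolding L_def by (rule PP[OF le(4)])
    \<comment> \<open>As \<open>q 1 t t = 0\<close>, the function \<open>f * \<tau>\<close> has
      parts only in the eigenspaces \<open>t - 1\<close> and \<open>t + 1\<close>. Multiplication by
      \<open>g\<close> cannot bring the upper part below \<open>t\<close>, nor the lower part above
      \<open>t\<close>.\<close>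
    have offt: "P h (g * F f) = (if h < t then P h (g * (f * \<tau>)) else 0)"
      if h: "h \<le> d" "h \<noteq> t" and f: "P 1 f = f" and g: "P 1 g = g" for f g h
    proof (cases "h < t")
      case True
      have "P h (g * P k (f * \<tau>)) = 0" if k: "k \<le> d" "k \<noteq> t - 1" for k
      proof -
        consider "k < t - 1" | "k = t" | "k > t" using k by linarith
        then show ?thesis
        proof cases
          case 1
          then have "P k (f * \<tau>) = 0"
            using k le f \<tau> by (intro P_mult_nonadjacent[of t]) auto
          then show ?thesis by simp
        next
          case 2
          then have "P k (f * \<tau>) = 0" using P_mult_zero[OF le(2) le(4) le(4) at f \<tau>] by simp
          then show ?thesis by simp
        next
          case 3
          then show ?thesis using k True h le g PP[OF k(1)] by (intro P_mult_nonadjacent[of k]) auto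
        qed
      qed
      then have "(\<Sum>k\<le>d. P h (g * P k (f * \<tau>))) = (\<Sum>k\<in>{t - 1}. P h (g * P k (f * \<tau>)))"
        using le by (intro sum.mono_neutral_right) auto
      moreover have "P h (g * (f * \<tau>)) = (\<Sum>k\<le>d. P h (g * P k (f * \<tau>)))"
        by (simp add: sum_P flip: P_sum sum_distrib_left)
      ultimately show ?thesis using True by (simp add: F_def)
    next
      case False
      then show ?thesis
        using h t le g PF P_mult_nonadjacent[of "t - 1" h g "F f"] by auto
    qed
    have sym: "g * F f - L g f = f * F g - L f g" if f: "P 1 f = f" and g: "P 1 g = g" for f g
    proof -
      have e: "g * F f - L g f = (\<Sum>h\<in>{..d} - {t}. if h < t then P h (g * (f * \<tau>)) else 0)"
        if f: "P 1 f = f" and g: "P 1 g = g" for f g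
      proof -
        have "g * F f = (\<Sum>h\<le>d. P h (g * F f))" by (simp add: sum_P)
        also have "\<dots> = L g f + (\<Sum>h\<in>{..d} - {t}. P h (g * F f))"
          using le by (subst sum.remove[of _ t]) (auto simp: L_def)
        also have "(\<Sum>h\<in>{..d} - {t}. P h (g * F f)) =
            (\<Sum>h\<in>{..d} - {t}. if h < t then P h (g * (f * \<tau>)) else 0)"
          by (intro sum.cong) (auto simp: offt[OF _ _ f g])
        finally show ?thesis by simp
      qed
      have "g * (f * \<tau>) = f * (g * \<tau>)" by (simp add: mult_ac)
      then show ?thesis by (simp only: e[OF f g] e[OF g f])
    qed
    define Y where "Y f = (\<Sum>y\<in>UNIV. E 1 $ y * L f (E 1 $ y))" for f
    have Pe: "P 1 (E 1 $ y) = E 1 $ y" for y using P_row[OF le(2) le(2)] by simp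
    have frame1: "(\<Sum>y\<in>UNIV. E 1 $ y * E 1 $ y) = (m / N) *\<^sub>R 1"
    proof (rule vec_eq_iff[THEN iffD2], rule allI)
      fix x
      have "(\<Sum>y\<in>UNIV. E 1 $ y * E 1 $ y) $ x = (\<Sum>y\<in>UNIV. E 1 $ x $ y * E 1 $ x $ y)"
        using E_sym[OF le(2)] by simp
      then show "(\<Sum>y\<in>UNIV. E 1 $ y * E 1 $ y) $ x = ((m / N) *\<^sub>R (1 :: real^'x)) $ x"
        by (simp add: E_row_E_row[OF le(2)] E_diag_trace[OF le(2)] m_def)
    qed
    \<comment> \<open>The hypothesis \<open>bt\<close> makes the coefficient exactly
      \<open>1 / N\<close>; this is the source of the \<open>m - 1\<close> in
      \<open>eq2\<close>.\<close>
    have frameL: "(\<Sum>y\<in>UNIV. E 1 $ y * L (E 1 $ y) f) = (1 / N) *\<^sub>R F f" for f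
      unfolding L_def using frame_mult_eigen[OF le(2) le(4) le(5) PF] bt by simp
    have frameF: "(\<Sum>y\<in>UNIV. E 1 $ y * F (E 1 $ y)) = (c / N) *\<^sub>R \<tau>"
      unfolding F_def c_def using frame_mult_eigen[OF le(2) le(5) le(4) \<tau>] by simp
    have eq1: "(m / N) *\<^sub>R F f - (1 / N) *\<^sub>R F f = (c / N) *\<^sub>R (f * \<tau>) - Y f" if f: "P 1 f = f" for f
    proof -
      have "(\<Sum>y\<in>UNIV. E 1 $ y * (E 1 $ y * F f - L (E 1 $ y) f))
          = (\<Sum>y\<in>UNIV. E 1 $ y * (f * F (E 1 $ y) - L f (E 1 $ y)))"
        using sym[OF f Pe] by simp
      moreover have "(\<Sum>y\<in>UNIV. E 1 $ y * (E 1 $ y * F f - L (E 1 $ y) f))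
          = (\<Sum>y\<in>UNIV. E 1 $ y * E 1 $ y) * F f - (\<Sum>y\<in>UNIV. E 1 $ y * L (E 1 $ y) f)"
        by (simp add: right_diff_distrib sum_subtractf sum_distrib_right mult.assoc)
      moreover have "(\<Sum>y\<in>UNIV. E 1 $ y * (f * F (E 1 $ y) - L f (E 1 $ y)))
          = f * (\<Sum>y\<in>UNIV. E 1 $ y * F (E 1 $ y)) - Y f"
        by (simp add: right_diff_distrib sum_subtractf sum_distrib_left mult_ac Y_def)
      ultimately show ?thesis by (simp add: frame1 frameL frameF)
    qed
    \<comment> \<open>By \<open>mult_t\<close> multiplication by \<open>g\<close> followed by
      \<open>P t\<close> only takes inner products with the rows, and the frame expansion of
      \<open>g\<close> then reassembles \<open>L f g\<close>.\<close>
    have PY: "P t (g * Y f) = (1 / N) *\<^sub>R L f g" if f: "P 1 f = f" and g: "P 1 g = g" for f g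
    proof -
      have "P t (g * Y f) = (\<Sum>y\<in>UNIV. (inner g (E 1 $ y) / N) *\<^sub>R L f (E 1 $ y))"
        unfolding Y_def sum_distrib_left P_sum
        by (intro sum.cong refl) (simp add: mult_t[OF g Pe PL] flip: mult.assoc)
      also have "\<dots> = (1 / N) *\<^sub>R L f (\<Sum>y\<in>UNIV. inner g (E 1 $ y) *\<^sub>R E 1 $ y)"
        by (simp add: L_def F_def sum_distrib_left sum_distrib_right P_sum P_scaleR scaleR_sum_right)
      finally show ?thesis by (simp add: frame_expand[OF le(2)] g)
    qed
    have eq2: "L f g + (m - 1) *\<^sub>R L g f = (c * inner f g / N) *\<^sub>R \<tau>"
      if f: "P 1 f = f" and g: "P 1 g = g" for f g
    proof -
      have "P t (g * ((m / N) *\<^sub>R F f - (1 / N) *\<^sub>R F f)) = P t (g * ((c / N) *\<^sub>R (f * \<tau>) - Y f))"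
        using eq1[OF f] by simp
      then have "(m / N) *\<^sub>R L g f - (1 / N) *\<^sub>R L g f = (c / N) *\<^sub>R P t (g * f * \<tau>) - (1 / N) *\<^sub>R L f g"
        by (simp add: right_diff_distrib P_diff P_scaleR PY[OF f g] L_def mult.assoc)
      then have "(m / N) *\<^sub>R L g f - (1 / N) *\<^sub>R L g f + (1 / N) *\<^sub>R L f g = (c / N) *\<^sub>R (inner g f / N) *\<^sub>R \<tau>"
        by (simp add: mult_t[OF g f \<tau>])
      then have "N *\<^sub>R ((m / N) *\<^sub>R L g f - (1 / N) *\<^sub>R L g f + (1 / N) *\<^sub>R L f g) = N *\<^sub>R ((c / N) *\<^sub>R (inner g f / N) *\<^sub>R \<tau>)"
        by simp
      then show ?thesis
        using N_pos by (simp add: scaleR_add_right scaleR_diff_right scaleR_diff_left inner_commute add.commute)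
    qed
    \<comment> \<open>Subtracting \<open>eq2\<close> from its version with \<open>f\<close> and
      \<open>g\<close> exchanged leaves the factor \<open>m - 2\<close>, which is nonzero. Thus
      \<open>L\<close> is symmetric, and \<open>eq2\<close> determines it.\<close>
    have eq3: "m *\<^sub>R L g f = (c * inner f g / N) *\<^sub>R \<tau>" if f: "P 1 f = f" and g: "P 1 g = g" for f g
    proof -
      have "(m - 2) *\<^sub>R (L g f - L f g) =
          (L f g + (m - 1) *\<^sub>R L g f) - (L g f + (m - 1) *\<^sub>R L f g)"
        by (simp add: algebra_simps scaleR_2)
      also have "\<dots> = 0" unfolding eq2[OF f g] eq2[OF g f] by (simp add: inner_commute)
      finally have "L g f = L f g" using m by (simp add: m_def)
      then show ?thesis using eq2[OF f g] by (simp add: algebra_simps)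
    qed
    have "m *\<^sub>R ((1 / N) *\<^sub>R F f) = (\<Sum>y\<in>UNIV. E 1 $ y * m *\<^sub>R L (E 1 $ y) f)"
      by (simp add: frameL[symmetric] scaleR_sum_right)
    also have "\<dots> = (c / N) *\<^sub>R ((\<Sum>y\<in>UNIV. inner f (E 1 $ y) *\<^sub>R E 1 $ y) * \<tau>)"
      by (simp add: eq3[OF f Pe] scaleR_sum_right sum_distrib_right)
    also have "\<dots> = (c / N) *\<^sub>R (f * \<tau>)" by (simp add: frame_expand[OF le(2)] f)
    finally have "N *\<^sub>R (m *\<^sub>R ((1 / N) *\<^sub>R F f)) = N *\<^sub>R ((c / N) *\<^sub>R (f * \<tau>))" by simp
    then show ?thesis using N_pos by (simp add: F_def)
  qed
  \<comment> \<open>By \<open>main\<close>, \<open>f * \<tau>\<close> lies in the eigenspace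
    \<open>t - 1\<close>, but a product of rows has a nonzero part in the eigenspace
    \<open>t + 1\<close>.\<close>
  have "c \<noteq> 0" using krein_add_neq_0(1)[of 1 "t - 1"] t by (simp add: c_def)
  have "c *\<^sub>R P (t + 1) (E 1 $ y * E t $ y) = 0" for y
  proof -
    have "P (t + 1) (m *\<^sub>R P (t - 1) (E 1 $ y * E t $ y)) = P (t + 1) (c *\<^sub>R (E 1 $ y * E t $ y))"
      using main[of "E 1 $ y" "E t $ y"] P_row le by simp
    moreover have "P (t + 1) (P (t - 1) f) = 0" for f
      using P_P[of "t + 1" "t - 1" f] t by auto
    ultimately show ?thesis by (simp add: P_scaleR)
  qed
  then have "(q 1 t (t + 1) / N) *\<^sub>R E (t + 1) $ y = 0" for y
    using \<open>c \<noteq> 0\<close> P_row_mult[of 1 t "t + 1" y] t by simp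
  then have "E (t + 1) $ y = 0" for y
    using krein_add_neq_0(1)[of 1 t] t N_pos by (simp add: add.commute)
  then show False using E_nonzero[of "t + 1"] t by (simp add: vec_eq_iff)
qed

section \<open>Forcing \<open>q 1 1 1 = 0\<close>\<close>

text \<open>With \<open>q 1 2 2 = 0\<close>, pairing \<open>P 1 (f * g)\<close> with
  \<open>h * k * s\<close> for \<open>s\<close> in \<open>V\<^sub>3\<close> is symmetric in all four
  functions of \<open>V\<^sub>1\<close>. If \<open>q 1 1 1\<close> were nonzero, this symmetry on
  squares of rows would force \<open>V\<^sub>1 * V\<^sub>3\<close> to miss
  \<open>V\<^sub>2\<close>.\<close>

lemma a_star_1_eq_0:
  assumes d: "3 \<le> d" and a2: "q 1 2 2 = 0"
  shows "q 1 1 1 = 0"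
proof (rule ccontr)
  assume a1: "q 1 1 1 \<noteq> 0"
  have le: "0 \<le> d" "1 \<le> d" "2 \<le> d" "3 \<le> d" using d by auto
  have PP: "P k (P k f) = P k f" if "k \<le> d" for k f
    using P_P[OF that that] by simp
  have mult_adj: "inner (f * g) h = inner f (g * h)" for f g h :: "real^'x"
    by (simp add: inner_vec_def mult.assoc)
  \<comment> \<open>The \<open>V\<^sub>2\<close> part of \<open>f * g * h\<close> comes only from
    the \<open>V\<^sub>1\<close> part of \<open>f * g\<close>, and \<open>V\<^sub>2\<close> is the
    only eigenspace that \<open>P 1 (f * g) * h\<close> and \<open>k * s\<close> can share. The
    right side is symmetric in \<open>f\<close>, \<open>g\<close>, \<open>h\<close>.\<close>
  have step: "inner (P 1 (f * g)) (h * k * s) = inner (P 2 (f * g * h)) (k * s)"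
    if f: "P 1 f = f" and g: "P 1 g = g" and h: "P 1 h = h" and k: "P 1 k = k" and s: "P 3 s = s"
    for f g h k s
  proof -
    have "P 2 (P l (f * g) * h) = 0" if l: "l \<le> d" "l \<noteq> 1" for l
    proof -
      consider "l = 0" | "l = 2" | "l > 2" using l by linarith
      then show ?thesis
      proof cases
        case 1
        have "P 2 h = 0" using P_P[OF le(3) le(2), of h] h by simp
        then show ?thesis using 1 by (simp add: P_0 P_scaleR)
      next
        case 2
        then show ?thesis
          using P_mult_zero[of 2 1 2] krein_zero_commute(1)[of 1 2 2] a2 le PP[of 2] h by auto
      next
        case 3
        then have "P l (f * g) = 0" using l le f g by (intro P_mult_nonadjacent[of 1]) auto
        then show ?thesis by simp
      qed
    qed
    then have "(\<Sum>l\<le>d. P 2 (P l (f * g) * h)) = (\<Sum>l\<in>{1}. P 2 (P l (f * g) * h))"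
      using le by (intro sum.mono_neutral_right) auto
    moreover have "P 2 (f * g * h) = (\<Sum>l\<le>d. P 2 (P l (f * g) * h))"
      by (simp add: sum_P flip: P_sum sum_distrib_right)
    ultimately have P2: "P 2 (f * g * h) = P 2 (P 1 (f * g) * h)" by simp
    have "inner (P l (P 1 (f * g) * h)) (k * s) = 0" if l: "l \<le> d" "l \<noteq> 2" for l
    proof (cases "l > 2")
      case True
      then have "P l (h * P 1 (f * g)) = 0"
        using l le h PP[OF le(2)] by (intro P_mult_nonadjacent[of 1]) auto
      then show ?thesis by (simp add: mult.commute)
    next
      case False
      then have "P l (k * s) = 0"
        using l le k s by (intro P_mult_nonadjacent[of 3]) auto
      moreover have "inner (P l (P 1 (f * g) * h)) (k * s) = inner (P l (P 1 (f * g) * h)) (P l (k * s))"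
        by (metis P_inner PP l(1))
      ultimately show ?thesis by simp
    qed
    then have "(\<Sum>l\<le>d. inner (P l (P 1 (f * g) * h)) (k * s)) = (\<Sum>l\<in>{2}. inner (P l (P 1 (f * g) * h)) (k * s))"
      using le by (intro sum.mono_neutral_right) auto
    moreover have "inner (P 1 (f * g) * h) (k * s) = (\<Sum>l\<le>d. inner (P l (P 1 (f * g) * h)) (k * s))"
      by (simp add: sum_P flip: inner_sum_left)
    moreover have "inner (P 1 (f * g)) (h * k * s) = inner (P 1 (f * g) * h) (k * s)"
      by (simp only: mult_adj mult.assoc)
    ultimately show ?thesis unfolding P2 by simp
  qed
  have swap: "inner (P 1 (f * g)) (h * k * s) = inner (P 1 (h * k)) (f * g * s)"
    if f: "P 1 f = f" and g: "P 1 g = g" and h: "P 1 h = h" and k: "P 1 k = k" and s: "P 3 s = s"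
    for f g h k s
  proof -
    have "inner (P 1 (f * g)) (h * k * s) = inner (P 2 (h * g * f)) (k * s)"
      unfolding step[OF f g h k s] by (simp only: mult_ac)
    also have "\<dots> = inner (P 1 (h * g)) (k * f * s)"
      unfolding step[OF h g f k s, symmetric] by (simp only: mult_ac)
    also have "\<dots> = inner (P 2 (h * k * g)) (f * s)"
      unfolding step[OF h g k f s] by (simp only: mult_ac)
    also have "\<dots> = inner (P 1 (h * k)) (f * g * s)"
      unfolding step[OF h k g f s, symmetric] by (simp only: mult_ac)
    finally show ?thesis .
  qed
  have P1: "P 1 (E 1 $ y) = E 1 $ y" for y using P_row[OF le(2) le(2)] by simp
  \<comment> \<open>The \<open>V\<^sub>1\<close> part of the square of a row is a multiple of that
    row by \<open>q 1 1 1\<close>. Cancelling this factor in \<open>swap\<close> exchanges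
    \<open>y\<close> and \<open>z\<close>, and expanding the square at \<open>z\<close> gives the
    right side.\<close>
  have "P 1 (E 1 $ y * E 1 $ y * s) = (1 / N) *\<^sub>R (\<Sum>l\<le>d. q 1 1 l *\<^sub>R P l (E 1 $ y * s))"
    if s: "P 3 s = s" for y s
  proof (rule vec_eq_iff[THEN iffD2], rule allI)
    fix z
    have row: "inner (E 1 $ z) u = P 1 u $ z" for u by (simp add: inner_vec_def P_nth)
    have "inner (E 1 $ z) (E 1 $ y * E 1 $ y * s) = inner (E 1 $ y) (E 1 $ z * E 1 $ z * s)"
      using swap[OF P1 P1 P1 P1 s, of z z y y] a1 N_pos by (simp add: P_row_mult[OF le(2) le(2) le(2)])
    also have "\<dots> = (\<Sum>x\<in>UNIV. (E 1 $ z $ x * E 1 $ z $ x) * (E 1 $ y * s) $ x)"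
      by (simp add: inner_vec_def mult_ac)
    also have "\<dots> = (\<Sum>x\<in>UNIV. \<Sum>l\<le>d. (1 / N) * (q 1 1 l * (E l $ z $ x * (E 1 $ y * s) $ x)))"
      by (simp only: krein_nth[OF le(2) le(2)] sum_distrib_left sum_distrib_right mult.assoc)
    also have "\<dots> = ((1 / N) *\<^sub>R (\<Sum>l\<le>d. q 1 1 l *\<^sub>R P l (E 1 $ y * s))) $ z"
      by (subst sum.swap) (simp add: P_nth sum_distrib_left)
    finally show "P 1 (E 1 $ y * E 1 $ y * s) $ z =
        ((1 / N) *\<^sub>R (\<Sum>l\<le>d. q 1 1 l *\<^sub>R P l (E 1 $ y * s))) $ z" by (simp add: row)
  qed
  \<comment> \<open>The left side of the identity lies in \<open>V\<^sub>1\<close>, so the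
    \<open>V\<^sub>2\<close> part of the right side must vanish.\<close>
  then have "P 2 (P 1 (E 1 $ y * E 1 $ y * s)) = (1 / N) *\<^sub>R (\<Sum>l\<le>d. q 1 1 l *\<^sub>R P 2 (P l (E 1 $ y * s)))"
    if "P 3 s = s" for y s
    using that by (simp add: P_scaleR P_sum)
  moreover have "(\<Sum>l\<le>d. q 1 1 l *\<^sub>R P 2 (P l f)) = (\<Sum>l\<le>d. if l = 2 then q 1 1 2 *\<^sub>R P 2 f else 0)" for f
    using le by (intro sum.cong) (auto simp: P_P)
  ultimately have "(q 1 1 2 / N) *\<^sub>R P 2 (E 1 $ y * s) = 0" if "P 3 s = s" for y s
    using that le by (auto simp: P_P)
  moreover have "q 1 1 2 \<noteq> 0" using krein_add_neq_0(1)[of 1 1] le by (simp add: numeral_2_eq_2)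
  ultimately have "P 2 (E 1 $ y * E 3 $ y) = 0" for y
    using N_pos P_row[OF le(4) le(4)] by simp
  moreover have "q 1 3 2 \<noteq> 0" using krein_add_neq_0(2)[of 1 2] le by simp
  ultimately have "E 2 $ y = 0" for y
    using P_row_mult[OF le(2) le(4) le(3), of y] N_pos by simp
  then show False using E_nonzero[OF le(3)] by (simp add: vec_eq_iff)
qed

section \<open>The exceptional Krein array\<close>

lemma not_excluded_krein_array:
  assumes d: "d = 6" and m: "trace (E 1) > 2"
  shows "\<not> excluded_krein_array (trace (E 1)) q"
proof
  assume "excluded_krein_array (trace (E 1)) q"
  then have ar: "q 1 1 0 = trace (E 1)" "q 1 3 2 = 1" "q 1 3 4 = 1" "q 1 2 3 = trace (E 1) - q 1 4 3"
    by (simp_all add: excluded_krein_array_def b_star_def c_star_def)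
  have up6: "{..d} = {0, 1, 2, 3, 4, 5, 6}" using d by auto
  have tri: "q 1 i j = 0" if "i \<le> 6" "j \<le> 6" "i + 1 < j \<or> j + 1 < i" for i j
    using that d by (intro krein_triangle) auto
  have a3: "q 1 3 3 = 0"
  proof -
    have "(\<Sum>l\<le>d. q 1 l 3) = trace (E 1)" using d by (intro sum_krein) auto
    then show ?thesis using ar by (simp add: up6 tri)
  qed
  \<comment> \<open>On the right the terms \<open>k = 2\<close> and \<open>k = 4\<close> add up to
    \<open>m\<close>, which is also the term \<open>k = 0\<close> on the left. The term
    \<open>k = 2\<close> on the left is all that remains.\<close>
  have "(\<Sum>k\<le>d. q 1 1 k * q k 3 3) = (\<Sum>k\<le>d. q 1 3 k * q 1 k 3)"
    using d by (intro krein_assoc) auto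
  then have "q 1 1 2 * q 2 3 3 = 0"
    unfolding up6 using ar a3 by (simp add: tri krein_0 d)
  moreover have "q 1 1 2 \<noteq> 0" using krein_add_neq_0(1)[of 1 1] d by (simp add: numeral_2_eq_2)
  ultimately show False using no_interior_unit_b_star[of 3] a3 ar d m by simp
qed

section \<open>The antipodal case\<close>

text \<open>Starting from \<open>{0, d}\<close>, closedness under multiplication by
  \<open>V\<^sub>d\<close> passes inwards to each pair \<open>{i, d - i}\<close>. Constancy of the
  sums over the pair next to \<open>i\<close> then compares the values at \<open>i\<close> and
  \<open>d - i\<close>.\<close>

lemma antipodal_of_closed:
  assumes d: "2 \<le> d" and closed0: "\<And>l. l \<le> d \<Longrightarrow> q d d l \<noteq> 0 \<Longrightarrow> l = 0 \<or> l = d"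
  shows "Q_antipodal d q"
proof -
  define closed where "closed C \<longleftrightarrow> (\<forall>h\<in>C. \<forall>l\<le>d. q d h l \<noteq> 0 \<longrightarrow> l \<in> C)" for C
  define D where "D i = {k. i < k \<and> k < d - i}" for i
  have tri: "q 1 k h = 0" if "k \<le> d" "h \<le> d" "k + 1 < h \<or> h + 1 < k" for k h
    using that d by (intro krein_triangle) auto
  have closed: "closed {i, d - i} \<and> closed (D i)" if "2 * i \<le> d" for i
    using that
  proof (induction i)
    case 0
    have c: "closed {0, d}"
      using closed0 krein_0 krein_zero_commute(1)[of d 0] d by (auto simp: closed_def split: if_splits)
    moreover have "closed (D 0)"
      unfolding closed_def
    proof (intro ballI allI impI)
      fix h l assume h: "h \<in> D 0" and l: "l \<le> d" "q d h l \<noteq> 0"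
      then have "q d l h \<noteq> 0" using krein_zero_commute(2)[of d h l] by (auto simp: D_def)
      moreover have "h \<notin> {0, d}" "h \<le> d" using h by (auto simp: D_def)
      ultimately have "l \<notin> {0, d}" using c unfolding closed_def by blast
      then show "l \<in> D 0" using l by (auto simp: D_def)
    qed
    ultimately show ?case by simp
  next
    case (Suc i)
    then have C: "closed {i, d - i}" and Di: "closed (D i)" and i: "2 * i + 2 \<le> d" by auto
    define w where "w h = (\<Sum>k\<in>{i, d - i}. q 1 k h)" for h
    have w: "w h = w l" if "h \<le> d" "l \<le> d" "q d h l \<noteq> 0" for h l
      unfolding w_def using C that d i by (intro sum_krein_closed[of _ d]) (auto simp: closed_def)
    \<comment> \<open>Inside \<open>D i\<close> only the next pair is adjacent to \<open>i\<close>
      or \<open>d - i\<close>, and nonnegativity prevents cancellation. So the invariant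
      \<open>w\<close> separates this pair from the rest of \<open>D i\<close>.\<close>
    have w_pos: "w h > 0 \<longleftrightarrow> h \<in> {Suc i, d - Suc i}" if h: "h \<in> D i" for h
    proof
      assume wh: "w h > 0"
      show "h \<in> {Suc i, d - Suc i}"
      proof (rule ccontr)
        assume "h \<notin> {Suc i, d - Suc i}"
        then have "i + 1 < h" "h + 1 < d - i" "h \<le> d" using h by (auto simp: D_def)
        then have "q 1 k h = 0" if "k \<in> {i, d - i}" for k using that tri i by auto
        then show False using wh by (simp add: w_def)
      qed
    next
      assume hh: "h \<in> {Suc i, d - Suc i}"
      have "q 1 k h \<ge> 0" if "k \<in> {i, d - i}" for k
        using that h d by (intro krein_nonneg) (auto simp: D_def)
      moreover have "\<exists>k\<in>{i, d - i}. q 1 k h > 0"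
      proof (cases "h = Suc i")
        case True
        then have "q 1 i h \<noteq> 0" using krein_add_neq_0(1)[of 1 i] i by (simp add: plus_1_eq_Suc)
        then show ?thesis using krein_nonneg[of 1 i h] i True by auto
      next
        case False
        then have "h = d - Suc i" "d - i = Suc h" using hh i by auto
        then have "q 1 (d - i) h \<noteq> 0" using krein_add_neq_0(2)[of 1 h] by (simp add: plus_1_eq_Suc)
        moreover have "h \<le> d" using h by (auto simp: D_def)
        ultimately have "q 1 (d - i) h > 0" using krein_nonneg[of 1 "d - i" h] i by simp
        then show ?thesis by simp
      qed
      ultimately show "w h > 0"
        unfolding w_def by (metis finite.emptyI finite.insertI sum_pos2)
    qed
    have mem: "{Suc i, d - Suc i} \<subseteq> D i" using i by (auto simp: D_def)
    have le: "h \<le> d" if "h \<in> D i" for h using that by (auto simp: D_def)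
    have step: "l \<in> D i \<and> (h \<in> {Suc i, d - Suc i} \<longleftrightarrow> l \<in> {Suc i, d - Suc i})"
      if "h \<in> D i" "l \<le> d" "q d h l \<noteq> 0" for h l
    proof -
      have "l \<in> D i" using Di that unfolding closed_def by blast
      then show ?thesis using w[of h l] w_pos[of h] w_pos[of l] that le by simp
    qed
    have DS: "D (Suc i) = D i - {Suc i, d - Suc i}" by (auto simp: D_def)
    show ?case
      unfolding closed_def DS using step mem by blast
  qed
  have "b_star d q i = c_star q (d - i)" if i: "i \<le> d" "i \<noteq> d div 2" for i
  proof (cases "i = d")
    case True
    then show ?thesis by (simp add: b_star_def c_star_def)
  next
    case False
    define C where "C = {i + 1, d - i - 1}"
    have "closed C"
    proof (cases "2 * (i + 1) \<le> d")
      case True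
      then show ?thesis using closed[of "i + 1"] by (simp add: C_def)
    next
      case F: False
      then have "2 * (d - i - 1) \<le> d" "d - (d - i - 1) = i + 1" using False i by auto
      then show ?thesis using closed[of "d - i - 1"] by (simp add: C_def insert_commute)
    qed
    moreover have "q d i (d - i) \<noteq> 0"
      using krein_add_neq_0(2)[of i "d - i"] krein_zero_commute(1)[of i d "d - i"] i by simp
    ultimately have "(\<Sum>k\<in>C. q 1 k i) = (\<Sum>k\<in>C. q 1 k (d - i))"
      using d i False by (intro sum_krein_closed[of _ d]) (auto simp: closed_def C_def)
    \<comment> \<open>Excluding \<open>d div 2\<close> rules out \<open>d - i = i\<close> and
      \<open>d - i = i + 1\<close>. Otherwise each sum over \<open>C\<close> reduces to one term;
      for \<open>d - i = i + 2\<close> the set \<open>C\<close> is a singleton.\<close>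
    moreover have sep: "d - i - 1 = i + 1 \<or> d - i < i \<or> i + 2 < d - i"
      using i False by presburger
    moreover have "q 1 (d - i - 1) i = 0 \<or> d - i - 1 = i + 1"
      using tri[of "d - i - 1" i] sep i False by auto
    moreover have "q 1 (i + 1) (d - i) = 0 \<or> d - i - 1 = i + 1"
      using tri[of "i + 1" "d - i"] sep i False by auto
    ultimately show ?thesis
      using False i by (auto simp: C_def b_star_def c_star_def split: if_splits)
  qed
  then show ?thesis by (simp add: Q_antipodal_def)
qed

section \<open>The bipartite case\<close>

text \<open>\<open>J\<close> is the set of even indices, which settles \<open>a_star\<close> there.
  At odd \<open>h\<close> the sum over \<open>J\<close> is \<open>m - a_star q h\<close>, and it is
  constant along steps of \<open>V\<^sub>2\<close>, so every odd value equals the first one, which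
  is zero.\<close>

lemma bipartite_of_closed:
  assumes d: "3 \<le> d" and J: "J \<subseteq> {..d}" "0 \<in> J" "2 \<in> J" "1 \<notin> J"
    and closed: "\<And>i j h. i \<in> J \<Longrightarrow> j \<in> J \<Longrightarrow> h \<le> d \<Longrightarrow> q i j h \<noteq> 0 \<Longrightarrow> h \<in> J"
  shows "Q_bipartite d q"
proof -
  \<comment> \<open>A nonzero value would, after permuting indices, put \<open>1\<close> into
    \<open>J\<close>.\<close>
  have no_adj: "q 1 j i = 0" if "i \<in> J" "j \<in> J" for i j
    using closed[of j i 1] krein_zero_commute[of 1 j i] krein_zero_commute[of j 1 i] that J d by auto
  have even_J: "2 * k \<in> J" if "2 * k \<le> d" for k
    using that
  proof (induction k)
    case (Suc k)
    then show ?case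
      using krein_add_neq_0(1)[of 2 "2 * k"] closed[of 2 "2 * k" "2 * Suc k"] J by auto
  qed (use J in simp)
  have J_even: "even h" if "h \<in> J" for h
  proof (rule ccontr)
    assume "odd h"
    then obtain k where "h = 2 * k + 1" by (elim oddE)
    then have "q 1 (2 * k) h = 0" using no_adj[of h "2 * k"] even_J[of k] J that by auto
    then show False using krein_add_neq_0(1)[of 1 "2 * k"] \<open>h = 2 * k + 1\<close> that J
      by (auto simp: add.commute)
  qed
  have mem_J: "h \<in> J \<longleftrightarrow> even h" if "h \<le> d" for h
    using that J_even even_J by (metis evenE)
  have a_even: "q 1 h h = 0" if "even h" "h \<le> d" for h
    using no_adj[of h h] mem_J that by simp
  have sum_J: "(\<Sum>k\<in>J. q 1 k h) = trace (E 1) - q 1 h h" if h: "odd h" "h \<le> d" for h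
  proof -
    have "(\<Sum>k\<in>{..d} - J. q 1 k h) = (\<Sum>k\<in>{h}. q 1 k h)"
    proof (rule sum.mono_neutral_right)
      show "\<forall>k\<in>{..d} - J - {h}. q 1 k h = 0"
      proof
        fix k assume "k \<in> {..d} - J - {h}"
        then have "odd k" "k \<le> d" "k \<noteq> h" using mem_J by auto
        then have "k + 1 < h \<or> h + 1 < k"
          using h(1) by (metis Suc_eq_plus1 even_Suc less_antisym linorder_neqE_nat not_less_eq)
        then show "q 1 k h = 0" using \<open>k \<le> d\<close> h d by (intro krein_triangle) auto
      qed
    qed (use h mem_J in auto)
    moreover have "(\<Sum>k\<le>d. q 1 k h) = (\<Sum>k\<in>J. q 1 k h) + (\<Sum>k\<in>{..d} - J. q 1 k h)"
      using J by (metis add.commute finite_atMost sum.subset_diff)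
    ultimately show ?thesis using sum_krein[of 1 h] h d by simp
  qed
  have a_odd: "q 1 (2 * k + 1) (2 * k + 1) = 0" if "2 * k + 1 \<le> d" for k
    using that
  proof (induction k)
    case 0
    then show ?case using a_star_1_eq_0[OF d] no_adj[of 2 2] J by simp
  next
    case (Suc k)
    let ?h = "2 * k + 1"
    have q2: "q 2 ?h (?h + 2) \<noteq> 0" using krein_add_neq_0(1)[of 2 ?h] Suc.prems by (simp add: add.commute)
    have "(\<Sum>i\<in>J. q 1 i ?h) = (\<Sum>i\<in>J. q 1 i (?h + 2))"
    proof (rule sum_krein_closed[of J 2, OF J(1) _ _ _ _ _ q2])
      show "l \<in> J" if "h \<in> J" "l \<le> d" "q 2 h l \<noteq> 0" for h l
        using closed[OF J(3) that] .
    qed (use d Suc.prems in auto)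
    then show ?case using sum_J[of ?h] sum_J[of "?h + 2"] Suc by simp
  qed
  have "q 1 h h = 0" if "h \<le> d" for h
    using a_even[of h] a_odd that by (metis oddE)
  then show ?thesis by (simp add: Q_bipartite_def a_star_def)
qed

section \<open>Case distinction on the least nonzero index of the closed set\<close>

lemma bipartite_or_antipodal:
  assumes J: "J \<subseteq> {..d}" "0 \<in> J" "J \<noteq> {0}" "J \<noteq> {..d}"
    and closed: "\<And>i j h. i \<in> J \<Longrightarrow> j \<in> J \<Longrightarrow> h \<le> d \<Longrightarrow> q i j h \<noteq> 0 \<Longrightarrow> h \<in> J"
    and m: "trace (E 1) > 2"
  shows "Q_bipartite d q \<or> Q_antipodal d q"
proof -
  have J1: "1 \<notin> J"
  proof
    assume 1: "1 \<in> J"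
    have "k \<in> J" if "k \<le> d" for k
      using that
    proof (induction k)
      case (Suc k)
      then show ?case using closed[OF 1, of k "Suc k"] krein_add_neq_0(1)[of 1 k] by (simp add: plus_1_eq_Suc)
    qed (use J in simp)
    then show False using J by auto
  qed
  define t where "t = (LEAST t. t \<in> J \<and> t \<noteq> 0)"
  have "\<exists>t. t \<in> J \<and> t \<noteq> 0" using J by auto
  then have t: "t \<in> J" "t \<noteq> 0"
    unfolding t_def by (metis (mono_tags, lifting) LeastI)+
  have t_min: "k \<notin> J" if "0 < k" "k < t" for k
    using not_less_Least[of k "\<lambda>t. t \<in> J \<and> t \<noteq> 0"] that by (auto simp: t_def)
  have t2: "2 \<le> t" using t J1 by (metis One_nat_def less_2_cases not_less)
  have td: "t \<le> d" using t J by auto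
  show ?thesis
  proof (cases "t = d")
    case True
    have "l = 0 \<or> l = d" if "l \<le> d" "q d d l \<noteq> 0" for l
      using closed[of d d l] t t_min[of l] that True by (metis le_neq_implies_less neq0_conv)
    then show ?thesis using antipodal_of_closed t2 True by simp
  next
    case False
    then have tltd: "t < d" using td by simp
    show ?thesis
    proof (cases "t = 2")
      case True
      have "Q_bipartite d q"
        by (rule bipartite_of_closed[OF _ J(1,2) _ J1 closed]) (use True t tltd in auto)
      then show ?thesis ..
    next
      case F: False
      then have t3: "3 \<le> t" using t2 by simp
      \<comment> \<open>A nonzero \<open>q k t t\<close> means a nonzero \<open>q t t k\<close>, so
        \<open>k\<close> would lie in \<open>J\<close> below its least nonzero element.\<close>
      have qt: "q k t t = 0" if "0 < k" "k < t" for k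
        using closed[of t t k] t_min[of k] krein_zero_commute(3)[of k t t] t that td by auto
      have tri: "q 1 k h = 0" if "k \<le> d" "h \<le> d" "k + 1 < h \<or> h + 1 < k" for k h
        using that tltd t2 by (intro krein_triangle) auto
      have sum1: "(\<Sum>k\<in>J. q 1 k 1) = (\<Sum>k\<in>{0}. q 1 k 1)"
      proof (rule sum.mono_neutral_right)
        show "\<forall>k\<in>J - {0}. q 1 k 1 = 0"
        proof
          fix k assume "k \<in> J - {0}"
          then have "1 + 1 < k" "k \<le> d" using t_min[of k] t3 J by (auto simp: not_less[symmetric])
          then show "q 1 k 1 = 0" using tri[of k 1] tltd t2 by simp
        qed
      qed (use J finite_subset in auto)
      have sumt: "(\<Sum>k\<in>J. q 1 k (t - 1)) = (\<Sum>k\<in>{t}. q 1 k (t - 1))"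
      proof (rule sum.mono_neutral_right)
        show "\<forall>k\<in>J - {t}. q 1 k (t - 1) = 0"
        proof
          fix k assume "k \<in> J - {t}"
          then have "k = 0 \<or> t - 1 + 1 < k" "k \<le> d" using t_min[of k] t3 J by (auto simp: not_less[symmetric])
          then show "q 1 k (t - 1) = 0" using tri[of k "t - 1"] tltd t3 by auto
        qed
      qed (use J finite_subset t in auto)
      have qt1: "q t 1 (t - 1) \<noteq> 0"
        using krein_add_neq_0(2)[of 1 "t - 1"] krein_zero_commute(1)[of 1 t "t - 1"] t3 td by simp
      \<comment> \<open>The indices \<open>1\<close> and \<open>t - 1\<close> are linked by
        multiplication by \<open>V\<^sub>t\<close>. At \<open>1\<close> only \<open>k = 0\<close>
        contributes, with value 1; at \<open>t - 1\<close> only \<open>k = t\<close> does. This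
        gives \<open>b_star d q (t - 1) = 1\<close>.\<close>
      have "(\<Sum>k\<in>J. q 1 k 1) = (\<Sum>k\<in>J. q 1 k (t - 1))"
      proof (rule sum_krein_closed[of J t, OF J(1) _ _ _ _ _ qt1])
        show "l \<in> J" if "h \<in> J" "l \<le> d" "q t h l \<noteq> 0" for h l
          using closed[OF t(1) that] .
      qed (use t3 td in auto)
      then have "q 1 t (t - 1) = 1"
        using sum1 sumt krein_commute[of 1 0 1] krein_0[of 1 1] tltd t2 by simp
      then show ?thesis
        using no_interior_unit_b_star[OF t2 tltd qt qt] t3 m by simp
    qed
  qed
qed

end

section \<open>Passage from association schemes to the function algebra\<close>

text \<open>A symmetric idempotent is the sum of the rank-one projections onto an orthonormal basis
  of its range, and each of them has trace 1.\<close>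

lemma rank_eq_trace:
  fixes A :: "real^'n::finite^'n"
  assumes sym: "transpose A = A" and idem: "A ** A = A"
  shows "real (rank A) = trace A"
proof -
  obtain B where B: "B \<subseteq> range ((*v) A)" "pairwise orthogonal B" "\<And>v. v \<in> B \<Longrightarrow> norm v = 1"
      "card B = dim (range ((*v) A))" "span B = range ((*v) A)" "independent B"
    using orthonormal_basis_subspace[OF linear_subspace_image[OF matrix_vector_mul_linear subspace_UNIV], of A]
    by metis
  have fin: "finite B" using B(6) independent_bound by blast
  have adj: "inner (A *v x) y = inner x (A *v y)" for x y
    using dot_lmul_matrix[of x A y] transpose_matrix_vector[of A x] sym by simp
  have AB: "A *v v = v" if "v \<in> B" for v
    using B(1) that idem by (auto simp: matrix_vector_mul_assoc)
  have diag: "A $ x $ x = (\<Sum>v\<in>B. (v $ x)\<^sup>2)" for x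
  proof -
    have "A *v axis x 1 = (\<Sum>v\<in>B. inner v (A *v axis x 1) *\<^sub>R v)"
      using orthonormal_basis_expand[OF B(2,3) _ fin, of "A *v axis x 1"] B(5)
      by (simp add: inner_commute)
    also have "\<dots> = (\<Sum>v\<in>B. (v $ x) *\<^sub>R v)"
      by (intro sum.cong refl) (simp add: AB inner_axis flip: adj)
    finally have "(A *v axis x 1) $ x = (\<Sum>v\<in>B. (v $ x) *\<^sub>R v) $ x" by simp
    then show ?thesis
      by (simp add: matrix_vector_mul_component inner_axis power2_eq_square)
  qed
  have "trace A = (\<Sum>v\<in>B. \<Sum>x\<in>UNIV. (v $ x)\<^sup>2)"
    unfolding trace_def diag by (rule sum.swap)
  also have "\<dots> = (\<Sum>v\<in>B. 1)"
  proof (rule sum.cong[OF refl])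
    fix v assume "v \<in> B"
    then have "inner v v = 1" using B(3) by (simp add: norm_eq_1)
    then show "(\<Sum>x\<in>UNIV. (v $ x)\<^sup>2) = 1" by (simp add: inner_vec_def power2_eq_square)
  qed
  finally show ?thesis by (simp add: rank_dim_range B(4))
qed

text \<open>Both properties are linear and hold for the adjacency matrices: the relations are
  symmetric, and only \<open>R 0\<close> meets the diagonal.\<close>

lemma bose_mesner_entries:
  assumes R: "sym_assoc_scheme d R" and M: "M \<in> bose_mesner d R"
  shows "M $ x $ y = M $ y $ x" "M $ x $ x = M $ y $ y"
proof -
  let ?S = "{M :: real^'a^'a. \<forall>x y. M $ x $ y = M $ y $ x \<and> M $ x $ x = M $ y $ y}"
  have "subspace ?S" by (auto simp: subspace_def; metis)
  moreover have "adj (R i) \<in> ?S" if i: "i \<le> d" for i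
  proof -
    have R0: "R 0 x y \<longleftrightarrow> x = y" and uniq: "\<exists>!i. i \<le> d \<and> R i x y" for x y
      using R unfolding sym_assoc_scheme_def by auto
    have "R i x x \<longleftrightarrow> i = 0" for x
      using R0[of x x] uniq[of x x] i by auto
    moreover have "R i x y \<longleftrightarrow> R i y x" for x y
      using R i unfolding sym_assoc_scheme_def by blast
    ultimately show ?thesis by (simp add: adj_def)
  qed
  ultimately have "bose_mesner d R \<subseteq> ?S"
    unfolding bose_mesner_def by (intro span_minimal) auto
  then show "M $ x $ y = M $ y $ x" "M $ x $ x = M $ y $ y" using M by auto
qed

lemma krein_algebra_scheme:
  fixes R :: "nat \<Rightarrow> 'x::finite \<Rightarrow> 'x \<Rightarrow> bool"
  assumes R: "sym_assoc_scheme d R" and E: "primitive_idempotents d R E" and q: "krein_params d E q"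
  shows "krein_algebra d E q (real CARD('x))"
  using E q bose_mesner_entries[OF R]
  by unfold_locales (auto simp: primitive_idempotents_def)

theorem theorem3p2:
  fixes d :: nat
    and R :: "nat \<Rightarrow> 'x::finite \<Rightarrow> 'x \<Rightarrow> bool"
    and E :: "nat \<Rightarrow> real^'x^'x"
    and q :: "nat \<Rightarrow> nat \<Rightarrow> nat \<Rightarrow> real"
  assumes "sym_assoc_scheme d R"
    and "primitive_idempotents d R E"
    and "krein_params d E q"
    and "imprimitive d R"
    and "cometric d q"
    and "rank (E 1) > 2"
  shows "(d = 6 \<longrightarrow> \<not> excluded_krein_array (real (rank (E 1))) q)
         \<and> (Q_bipartite d q \<or> Q_antipodal d q)"
proof -
  interpret krein_algebra d E q "real CARD('x)"
    using assms by (intro krein_algebra_scheme)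
  interpret cometric_algebra d E q "real CARD('x)"
    using assms by unfold_locales
  obtain i where i: "1 \<le> i" "i \<le> d" "\<not> (\<forall>x y. (R i)\<^sup>*\<^sup>* x y)"
    using assms(4) unfolding imprimitive_def by auto
  have "real (rank (E 1)) = trace (E 1)"
    using i E_orth[of 1 1] E_sym[of 1] by (intro rank_eq_trace) (auto simp: transpose_def vec_eq_iff)
  then have m: "real (rank (E 1)) = trace (E 1)" "trace (E 1) > 2" using assms(6) by auto
  have "adj (R i) \<in> bose_mesner d R"
    unfolding bose_mesner_def using i by (intro span_base) auto
  then obtain p where p: "adj (R i) = (\<Sum>j\<le>d. p j *\<^sub>R E j)"
    using span_E assms(2) unfolding primitive_idempotents_def by metis
  have sym: "R i x y \<longleftrightarrow> R i y x" for x y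
    using assms(1) i unfolding sym_assoc_scheme_def by blast
  have edge: "\<exists>x y. R i x y \<and> x \<noteq> y"
  proof -
    have "\<forall>i\<le>d. \<exists>x y. R i x y" "\<forall>x y. R 0 x y \<longleftrightarrow> x = y" and uniq: "\<forall>x y. \<exists>!k. k \<le> d \<and> R k x y"
      using assms(1) unfolding sym_assoc_scheme_def by simp_all
    then obtain x y where xy: "R i x y" and R0: "R 0 x y \<longleftrightarrow> x = y" using i(2) by blast
    have "x \<noteq> y"
    proof
      assume "x = y"
      then have "0 \<le> d \<and> R 0 x y" "i \<le> d \<and> R i x y" using R0 xy i by auto
      then have "i = 0" using uniq by blast
      then show False using i(1) by simp
    qed
    then show ?thesis using xy by auto
  qed
  have disc: "\<exists>x y. \<not> (R i)\<^sup>*\<^sup>* x y" using i(3) by simp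
  have "Q_bipartite d q \<or> Q_antipodal d q"
    by (rule imprimitive_closed_set[OF sym p edge disc], rule bipartite_or_antipodal) (assumption | rule m(2))+
  moreover have "d = 6 \<longrightarrow> \<not> excluded_krein_array (real (rank (E 1))) q"
    unfolding m(1) using not_excluded_krein_array m(2) by blast
  ultimately show ?thesis by blast
qed

end
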